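(* Let $2\le r<\infty$, $2^{r-1}\le n\le2^r-1$, let $j_1,\dots,j_n$ be non-negative integers, $|j|=j_1+\dots+j_n$, and let $f$ be an original on $\mathbf R^n$ with values in $\mathcal A_r$. (1) For the spherical kernel (S), if $\partial^{|j|}f(t)/\partial s_1^{j_1}\cdots\partial s_n^{j_n}$ is an original, then $$\mathcal F^n(\partial^{|j|}f(t)/\partial s_1^{j_1}\cdots\partial s_n^{j_n},u;p;\zeta)=\sum_{0\le k_1\le j_1}\binom{j_1}{k_1}p_0^{j_1-k_1}(p_1\mathsf S_{e_1})^{k_1}(p_2\mathsf S_{e_2})^{j_2}\cdots(p_n\mathsf S_{e_n})^{j_n}\mathcal F^n(f(t),u;p;\zeta).$$ (1.1) For the Cartesian kernel (C), if $\partial^{|j|}f(t)/\partial t_1^{j_1}\cdots\partial t_n^{j_n}$ is an original, then $$\mathcal F^n(\partial^{|j|}f(t)/\partial t_1^{j_1}\cdots\partial t_n^{j_n},u;p;\zeta)=(p_0+p_1\mathsf S_{e_1})^{j_1}(p_0+p_2\mathsf S_{e_2})^{j_2}\cdots(p_0+p_n\mathsf S_{e_n})^{j_n}\mathcal F^n(f(t),u;p;\zeta).$$ These formulas hold in the domain $a_1<\mathrm{Re}(p)<a_{-1}$, provided $a_1<a_{-1}$, where $a_{-1}=\min\big(a_{-1}(f),\,a_{-1}(\partial^{|m|}f/\partial\phi_1^{m_1}\cdots\partial\phi_n^{m_n}):|m|\le|j|,\,0\le m_l\le j_l\ \forall l\big)$ and $a_1=\max\big(a_1(f),\,a_1(\partial^{|m|}f/\partial\phi_1^{m_1}\cdots\partial\phi_n^{m_n}):|m|\le|j|,\,0\le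 m_l\le j_l\ \forall l\big)$, with $\phi_l=s_l$ in case (1) and $\phi_l=t_l$ in case (1.1). Here $\mathsf S_{e_k}=-\partial/\partial\zeta_k$ and powers denote iteration.
   Context: Cayley–Dickson algebras: $\mathcal A_0=\mathbf R$ and $\mathcal A_{r+1}=\mathcal A_r\oplus\mathcal A_r\mathbf l$ with $(\xi+\eta\mathbf l)(\gamma+\delta\mathbf l)=(\xi\gamma-\delta^*\eta)+(\delta\xi+\eta\gamma^* )\mathbf l$, $(\xi+\eta\mathbf l)^*=\xi^*-\eta\mathbf l$. The standard basis of $\mathcal A_r$ is $i_0=1,i_1,\dots,i_{2^r-1}$, with $i_j^2=-1$, $i_ji_k=-i_ki_j$ for $j\ne k$, $j,k\ge1$. $\mathrm{Re}(z)=(z+z^* )/2$, $|z|^2=zz^*$, $\exp(z)=\sum_kz^k/k!$. Write $p=\sum_jp_ji_j$, $\zeta=\sum_j\zeta_ji_j$ with real $p_j,\zeta_j$. When $n<2^r-1$ one puts $p_m=\zeta_m=t_m=0$ for $m>n$. The variables $s_1,\dots,s_n$ are the linear coordinates $s_j=t_j+\dots+t_n$ on $\mathbf R^n$ (so $t_j=s_j-s_{j+1}$, $s_{n+1}=0$); $\partial/\partial s_j$ is the partial derivative of $f(t(s))$ in these coordinates. Originals: $f:\mathbf R^n\to\mathcal A_r$ is an original if (1) $f$ is continuous almost everywhere for the Lebesgue measure; (2) each partial function $t_j\mapsto f(t)$ has on each finite interval only finitely many discontinuities, all of the first kind; (3) each partial function $g_j(t_j)=f(t)$ satisfies, except possibly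 at its discontinuities of the first kind, a Hölder condition $|g_j(t_j+h)-g_j(t_j)|\le A_j|h|^{\alpha_j}$ for $|h|<\delta_j$, with constants $0<\alpha_j\le1$, $A_j,\delta_j>0$ (for the given $t$); (4) there are real $a_1(f),a_{-1}(f)$ and constants $C_v>0$ such that for each $v\in\{-1,1\}^n$, $|f(t)|<C_v\exp(\sum_ja_{v_j}t_j)$ whenever $v_jt_j\ge0$ for all $j$. Kernels: (C) Cartesian: $u(p,t;\zeta)=p_0(t_1+\dots+t_n)+\sum_{j=1}^np_jt_ji_j+\zeta$. (S) Spherical: with $K=2^r-1$, $\phi_j=p_js_j+\zeta_j$: $u=p_0s_1+M+\zeta_0$, $M=\phi_1[i_1\cos\phi_2+i_2\sin\phi_2\cos\phi_3+\dots+i_{K-1}\sin\phi_2\cdots\sin\phi_{K-1}\cos\phi_K+i_K\sin\phi_2\cdots\sin\phi_K]$ (these $\phi_j$ are unrelated to the coordinates $\phi_l$ in the claim). Transform: $\mathcal F^n(f(t),u;p;\zeta)=\int_{\mathbf R^n}f(t)\exp(-u(p,t;\zeta))\,dt$. *)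

theory Defs
  imports "HOL-Analysis.Analysis"
begin

section \<open>Cayley--Dickson algebras\<close>

text \<open>
  An element of the algebra of dimension \<open>2 ^ r\<close> is the sequence of its real coordinates in the
  standard basis, vanishing from index \<open>2 ^ r\<close> on.  The standard basis follows the doubling:
  \<open>i\<^sub>k\<close> for \<open>k < 2 ^ r\<close> is the basis element of the first summand, and
  the basis element of index \<open>2 ^ r + k\<close> is \<open>i\<^sub>k l\<close>.  Integrals, series and derivatives of
  functions with values in this finite-dimensional space are taken coordinatewise, and the
  topology of pointwise convergence on \<^typ>\<open>nat \<Rightarrow> real\<close> induces the usual topology on it.
\<close>

type_synonym cd = "nat \<Rightarrow> real"

definition cd_carrier :: "nat \<Rightarrow> cd set" where
  "cd_carrier r = {z. \<forall>k\<ge>2 ^ r. z k = 0}"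

definition cd_unit :: "nat \<Rightarrow> cd" where
  "cd_unit k = (\<lambda>l. if l = k then 1 else 0)"

definition cd_fst :: "nat \<Rightarrow> cd \<Rightarrow> cd" where
  "cd_fst r z = (\<lambda>k. if k < 2 ^ r then z k else 0)"

definition cd_snd :: "nat \<Rightarrow> cd \<Rightarrow> cd" where
  "cd_snd r z = (\<lambda>k. if k < 2 ^ r then z (2 ^ r + k) else 0)"

text \<open>\<open>cd_pair r \<xi> \<eta>\<close> is \<open>\<xi> + \<eta> l\<close>.\<close>

definition cd_pair :: "nat \<Rightarrow> cd \<Rightarrow> cd \<Rightarrow> cd" where
  "cd_pair r \<xi> \<eta> = (\<lambda>k. if k < 2 ^ r then \<xi> k else \<eta> (k - 2 ^ r))"

primrec cd_conj :: "nat \<Rightarrow> cd \<Rightarrow> cd" where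
  "cd_conj 0 z = z"
| "cd_conj (Suc r) z = cd_pair r (cd_conj r (cd_fst r z)) (\<lambda>k. - cd_snd r z k)"

primrec cd_mult :: "nat \<Rightarrow> cd \<Rightarrow> cd \<Rightarrow> cd" where
  "cd_mult 0 x y = (\<lambda>k. if k = 0 then x 0 * y 0 else 0)"
| "cd_mult (Suc r) x y =
    (let \<xi> = cd_fst r x; \<eta> = cd_snd r x; \<gamma> = cd_fst r y; \<delta> = cd_snd r y
     in cd_pair r
          (\<lambda>k. cd_mult r \<xi> \<gamma> k - cd_mult r (cd_conj r \<delta>) \<eta> k)
          (\<lambda>k. cd_mult r \<delta> \<xi> k + cd_mult r \<eta> (cd_conj r \<gamma>) k))"

text \<open>\<open>(z + z\<^sup>*) / 2\<close> and \<open>z z\<^sup>*\<close> are real multiples of the unit; the coefficient is taken.\<close>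

definition cd_Re :: "nat \<Rightarrow> cd \<Rightarrow> real" where
  "cd_Re r z = (z 0 + cd_conj r z 0) / 2"

definition cd_norm :: "nat \<Rightarrow> cd \<Rightarrow> real" where
  "cd_norm r z = sqrt (cd_mult r z (cd_conj r z) 0)"

primrec cd_power :: "nat \<Rightarrow> cd \<Rightarrow> nat \<Rightarrow> cd" where
  "cd_power r z 0 = cd_unit 0"
| "cd_power r z (Suc k) = cd_mult r z (cd_power r z k)"

definition cd_exp :: "nat \<Rightarrow> cd \<Rightarrow> cd" where
  "cd_exp r z = (\<lambda>l. \<Sum>k. cd_power r z k l / fact k)"

text \<open>The admissible \<open>p\<close> and \<open>\<zeta>\<close>, which have no components of index beyond \<open>n\<close>.\<close>

definition cd_params :: "nat \<Rightarrow> nat \<Rightarrow> cd set" where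
  "cd_params r n = {z \<in> cd_carrier r. \<forall>k>n. z k = 0}"


section \<open>Coordinates on the Euclidean space\<close>

text \<open>
  A map \<open>e\<close> with \<open>bij_betw e {1..CARD('n)} UNIV\<close> numbers the coordinates of \<^typ>\<open>real ^ 'n\<close>
  as \<open>t\<^sub>1, \<dots>, t\<^sub>n\<close>; coordinates of index beyond \<open>n\<close> are \<open>0\<close>.
\<close>

definition coord :: "(nat \<Rightarrow> 'n::finite) \<Rightarrow> real ^ 'n \<Rightarrow> nat \<Rightarrow> real" where
  "coord e t k = (if k \<in> {1..CARD('n)} then t $ e k else 0)"

definition tail_sum :: "(nat \<Rightarrow> 'n::finite) \<Rightarrow> real ^ 'n \<Rightarrow> nat \<Rightarrow> real" where
  "tail_sum e t k = (\<Sum>l = k..CARD('n). coord e t l)"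

definition s_of_t :: "(nat \<Rightarrow> 'n::finite) \<Rightarrow> real ^ 'n \<Rightarrow> real ^ 'n" where
  "s_of_t e t = (\<chi> i. tail_sum e t (inv_into {1..CARD('n)} e i))"

definition t_of_s :: "(nat \<Rightarrow> 'n::finite) \<Rightarrow> real ^ 'n \<Rightarrow> real ^ 'n" where
  "t_of_s e s = (\<chi> i. s $ i - coord e s (inv_into {1..CARD('n)} e i + 1))"


section \<open>Iterated partial derivatives\<close>

text \<open>
  In the following \<open>sh k x h\<close> is the point \<open>x\<close> with its \<open>k\<close>-th coordinate increased by \<open>h\<close>.
  The derivative of multi-index \<open>m\<close> is
  \<open>\<partial>\<^sub>1 ^ m\<^sub>1 (\<partial>\<^sub>2 ^ m\<^sub>2 (\<dots> (\<partial>\<^sub>n ^ m\<^sub>n g)))\<close>; it exists on \<open>X\<close> if all partial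
  derivatives taken in this chain exist at every point of \<open>X\<close>.
\<close>

definition pderiv_along :: "(nat \<Rightarrow> 'x \<Rightarrow> real \<Rightarrow> 'x) \<Rightarrow> nat \<Rightarrow> ('x \<Rightarrow> cd) \<Rightarrow> 'x \<Rightarrow> cd" where
  "pderiv_along sh k g x = (\<lambda>i. deriv (\<lambda>h. g (sh k x h) i) 0)"

definition pdifferentiable_along ::
    "(nat \<Rightarrow> 'x \<Rightarrow> real \<Rightarrow> 'x) \<Rightarrow> 'x set \<Rightarrow> nat \<Rightarrow> ('x \<Rightarrow> cd) \<Rightarrow> bool" where
  "pdifferentiable_along sh X k g \<longleftrightarrow>
    (\<forall>x\<in>X. \<forall>i. (\<lambda>h. g (sh k x h) i) field_differentiable at 0)"

definition mixed_pderiv ::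
    "(nat \<Rightarrow> 'x \<Rightarrow> real \<Rightarrow> 'x) \<Rightarrow> nat \<Rightarrow> (nat \<Rightarrow> nat) \<Rightarrow> ('x \<Rightarrow> cd) \<Rightarrow> 'x \<Rightarrow> cd" where
  "mixed_pderiv sh n m g = foldr (\<lambda>k. pderiv_along sh k ^^ m k) [1..<Suc n] g"

definition mixed_pderiv_exists ::
    "(nat \<Rightarrow> 'x \<Rightarrow> real \<Rightarrow> 'x) \<Rightarrow> 'x set \<Rightarrow> nat \<Rightarrow> (nat \<Rightarrow> nat) \<Rightarrow> ('x \<Rightarrow> cd) \<Rightarrow> bool" where
  "mixed_pderiv_exists sh X n m g \<longleftrightarrow>
    (\<forall>k\<in>{1..n}. \<forall>l<m k. pdifferentiable_along sh X k
      ((pderiv_along sh k ^^ l) (foldr (\<lambda>k. pderiv_along sh k ^^ m k) [Suc k..<Suc n] g)))"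

definition vec_shift :: "(nat \<Rightarrow> 'n::finite) \<Rightarrow> nat \<Rightarrow> real ^ 'n \<Rightarrow> real \<Rightarrow> real ^ 'n" where
  "vec_shift e k t h = t + h *\<^sub>R axis (e k) 1"

definition cd_shift :: "nat \<Rightarrow> cd \<Rightarrow> real \<Rightarrow> cd" where
  "cd_shift k \<zeta> h = \<zeta>(k := \<zeta> k + h)"

definition t_pderiv :: "(nat \<Rightarrow> 'n::finite) \<Rightarrow> (nat \<Rightarrow> nat) \<Rightarrow> (real ^ 'n \<Rightarrow> cd) \<Rightarrow> real ^ 'n \<Rightarrow> cd" where
  "t_pderiv e m f = mixed_pderiv (vec_shift e) CARD('n) m f"

definition t_pderiv_exists :: "(nat \<Rightarrow> 'n::finite) \<Rightarrow> (nat \<Rightarrow> nat) \<Rightarrow> (real ^ 'n \<Rightarrow> cd) \<Rightarrow> bool" where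
  "t_pderiv_exists e m f \<longleftrightarrow> mixed_pderiv_exists (vec_shift e) UNIV CARD('n) m f"

definition s_pderiv :: "(nat \<Rightarrow> 'n::finite) \<Rightarrow> (nat \<Rightarrow> nat) \<Rightarrow> (real ^ 'n \<Rightarrow> cd) \<Rightarrow> real ^ 'n \<Rightarrow> cd" where
  "s_pderiv e m f = (\<lambda>t. t_pderiv e m (f \<circ> t_of_s e) (s_of_t e t))"

definition s_pderiv_exists :: "(nat \<Rightarrow> 'n::finite) \<Rightarrow> (nat \<Rightarrow> nat) \<Rightarrow> (real ^ 'n \<Rightarrow> cd) \<Rightarrow> bool" where
  "s_pderiv_exists e m f \<longleftrightarrow> t_pderiv_exists e m (f \<circ> t_of_s e)"

definition multi_below :: "nat \<Rightarrow> (nat \<Rightarrow> nat) \<Rightarrow> (nat \<Rightarrow> nat) set" where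
  "multi_below n j = {m. (\<forall>l\<in>{1..n}. m l \<le> j l) \<and> (\<forall>l. l \<notin> {1..n} \<longrightarrow> m l = 0)}"


section \<open>Originals\<close>

definition line_fun :: "(real ^ 'n \<Rightarrow> cd) \<Rightarrow> real ^ 'n \<Rightarrow> 'n::finite \<Rightarrow> real \<Rightarrow> cd" where
  "line_fun f t i x = f (\<chi> k. if k = i then x else t $ k)"

definition first_kind_disc :: "(real \<Rightarrow> cd) \<Rightarrow> real \<Rightarrow> bool" where
  "first_kind_disc g x \<longleftrightarrow> \<not> isCont g x \<and>
    (\<exists>L. (g \<longlongrightarrow> L) (at_left x)) \<and> (\<exists>R. (g \<longlongrightarrow> R) (at_right x))"

definition exp_growth :: "nat \<Rightarrow> real \<Rightarrow> real \<Rightarrow> (real ^ 'n::finite \<Rightarrow> cd) \<Rightarrow> bool" where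
  "exp_growth r a b f \<longleftrightarrow>
    (\<forall>v::'n \<Rightarrow> real. range v \<subseteq> {-1, 1} \<longrightarrow>
      (\<exists>C>0. \<forall>t. (\<forall>i. v i * t $ i \<ge> 0) \<longrightarrow>
        cd_norm r (f t) < C * exp (\<Sum>i\<in>UNIV. (if v i = 1 then a else b) * t $ i)))"

definition is_original :: "nat \<Rightarrow> (real ^ 'n::finite \<Rightarrow> cd) \<Rightarrow> bool" where
  "is_original r f \<longleftrightarrow>
    (\<forall>t. f t \<in> cd_carrier r) \<and>
    (AE t in lebesgue. isCont f t) \<and>
    (\<forall>t i. (\<forall>c d. finite {x \<in> {c..d}. \<not> isCont (line_fun f t i) x}) \<and>
           (\<forall>x. \<not> isCont (line_fun f t i) x \<longrightarrow> first_kind_disc (line_fun f t i) x)) \<and>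
    (\<forall>t i. \<not> first_kind_disc (line_fun f t i) (t $ i) \<longrightarrow>
      (\<exists>A>0. \<exists>\<alpha>>0. \<exists>\<delta>>0. \<alpha> \<le> 1 \<and> (\<forall>h. \<bar>h\<bar> < \<delta> \<longrightarrow>
        cd_norm r (\<lambda>k. line_fun f t i (t $ i + h) k - line_fun f t i (t $ i) k)
          \<le> A * \<bar>h\<bar> powr \<alpha>))) \<and>
    (\<exists>a b. exp_growth r a b f)"


section \<open>Kernels and the transform\<close>

definition cart_kernel :: "(nat \<Rightarrow> 'n::finite) \<Rightarrow> cd \<Rightarrow> real ^ 'n \<Rightarrow> cd \<Rightarrow> cd" where
  "cart_kernel e p t \<zeta> = (\<lambda>i.
    p 0 * (\<Sum>k = 1..CARD('n). coord e t k) * cd_unit 0 i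
    + (\<Sum>k = 1..CARD('n). p k * coord e t k * cd_unit k i)
    + \<zeta> i)"

definition sph_phase :: "(nat \<Rightarrow> 'n::finite) \<Rightarrow> cd \<Rightarrow> real ^ 'n \<Rightarrow> cd \<Rightarrow> nat \<Rightarrow> real" where
  "sph_phase e p t \<zeta> k = p k * tail_sum e t k + \<zeta> k"

definition sph_M :: "nat \<Rightarrow> (nat \<Rightarrow> real) \<Rightarrow> cd" where
  "sph_M K \<phi> = (\<lambda>i. \<phi> 1 *
    ((\<Sum>k = 1..K - 1. (\<Prod>l = 2..k. sin (\<phi> l)) * cos (\<phi> (k + 1)) * cd_unit k i)
     + (\<Prod>l = 2..K. sin (\<phi> l)) * cd_unit K i))"

definition sph_kernel :: "nat \<Rightarrow> (nat \<Rightarrow> 'n::finite) \<Rightarrow> cd \<Rightarrow> real ^ 'n \<Rightarrow> cd \<Rightarrow> cd" where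
  "sph_kernel r e p t \<zeta> = (\<lambda>i.
    p 0 * tail_sum e t 1 * cd_unit 0 i
    + sph_M (2 ^ r - 1) (sph_phase e p t \<zeta>) i
    + \<zeta> 0 * cd_unit 0 i)"

definition transform_integrand ::
    "nat \<Rightarrow> (cd \<Rightarrow> real ^ 'n::finite \<Rightarrow> cd \<Rightarrow> cd) \<Rightarrow> (real ^ 'n \<Rightarrow> cd) \<Rightarrow> cd \<Rightarrow> cd \<Rightarrow> real ^ 'n \<Rightarrow> cd" where
  "transform_integrand r u f p \<zeta> t = cd_mult r (f t) (cd_exp r (\<lambda>k. - u p t \<zeta> k))"

definition transform ::
    "nat \<Rightarrow> (cd \<Rightarrow> real ^ 'n::finite \<Rightarrow> cd \<Rightarrow> cd) \<Rightarrow> (real ^ 'n \<Rightarrow> cd) \<Rightarrow> cd \<Rightarrow> cd \<Rightarrow> cd" where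
  "transform r u f p \<zeta> = (\<lambda>i. LINT t|lebesgue. transform_integrand r u f p \<zeta> t i)"

definition transform_converges ::
    "nat \<Rightarrow> (cd \<Rightarrow> real ^ 'n::finite \<Rightarrow> cd \<Rightarrow> cd) \<Rightarrow> (real ^ 'n \<Rightarrow> cd) \<Rightarrow> cd \<Rightarrow> cd \<Rightarrow> bool" where
  "transform_converges r u f p \<zeta> \<longleftrightarrow>
    (\<forall>i. integrable lebesgue (\<lambda>t. transform_integrand r u f p \<zeta> t i))"

text \<open>The operators \<open>S\<^sub>e\<^sub>k = - \<partial> / \<partial>\<zeta>\<^sub>k\<close>, \<open>p\<^sub>k S\<^sub>e\<^sub>k\<close> and
  \<open>p\<^sub>0 + p\<^sub>k S\<^sub>e\<^sub>k\<close> on functions of \<open>\<zeta>\<close>.\<close>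

definition S_op :: "nat \<Rightarrow> (cd \<Rightarrow> cd) \<Rightarrow> cd \<Rightarrow> cd" where
  "S_op k G = (\<lambda>\<zeta> i. - pderiv_along cd_shift k G \<zeta> i)"

definition pS_op :: "cd \<Rightarrow> nat \<Rightarrow> (cd \<Rightarrow> cd) \<Rightarrow> cd \<Rightarrow> cd" where
  "pS_op p k G = (\<lambda>\<zeta> i. p k * S_op k G \<zeta> i)"

definition p0_pS_op :: "cd \<Rightarrow> nat \<Rightarrow> (cd \<Rightarrow> cd) \<Rightarrow> cd \<Rightarrow> cd" where
  "p0_pS_op p k G = (\<lambda>\<zeta> i. p 0 * G \<zeta> i + pS_op p k G \<zeta> i)"

end

theory Submission
  imports Defs
begin

text \<open>
  Both kernels have the form
  \<open>exp (- u) = exp (- (p\<^sub>0 (t\<^sub>1 + \<dots> + t\<^sub>n) + \<zeta>\<^sub>0)) \<Psi> (\<psi>)\<close> with phases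
  \<open>\<psi>\<^sub>k = p\<^sub>k \<tau>\<^sub>k (t) + \<zeta>\<^sub>k\<close>, where the functionals \<open>\<tau>\<^sub>k\<close> are dual to the directions of
  differentiation.  Along the \<open>k\<close>-th direction the kernel therefore satisfies
  \<open>\<partial> exp (- u) = - \<sigma>\<^sub>k p\<^sub>0 exp (- u) + p\<^sub>k (\<partial> / \<partial>\<zeta>\<^sub>k) exp (- u)\<close>, where \<open>\<sigma>\<^sub>k\<close> is the increment of
  \<open>t\<^sub>1 + \<dots> + t\<^sub>n\<close>: it is \<open>1\<close> for the variables \<open>t\<^sub>k\<close>, and \<open>1\<close> or \<open>0\<close> for \<open>s\<^sub>k\<close> according to
  \<open>k = 1\<close> or \<open>k > 1\<close>.  Integrating by parts moves the derivative from \<open>f\<close> to the kernel.  The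
  growth conditions make the integrands decay exponentially because \<open>\<Psi>\<close> and all its
  derivatives grow subexponentially.
  The boundary terms are avoided by differentiating the constant function
  \<open>h \<mapsto> \<integral> H (t + h d) dt\<close> under the integral sign, which needs no continuity of the
  partial derivatives of \<open>f\<close>.
\<close>

section \<open>The exponential function of a Cayley--Dickson algebra\<close>

text \<open>What survives is that every element satisfies a real quadratic equation. Hence exp z =
  e^(z_0) (cos \<rho> + (sin \<rho> / \<rho>) Im z), where \<rho>^2 is the squared length of the
  imaginary part. Each coordinate of the kernel is then an explicit real function, and the
  multiplication table enters only through constant coefficients of real integrals.

  The obstacle is the quotient at \<rho> = 0. In the Cartesian case \<rho> is the length of the
  phase vector, which is not smooth there, so cos \<rho> and sin \<rho> / \<rho> are expressed by
  the entire function cos \<surd>y and its derivative at y = \<rho>^2; all its derivatives are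
  bounded for y \<ge> 0, which gives the subexponential growth. In the spherical case the imaginary
  part is a phase times a unit vector, and this phase cancels the denominator.\<close>

lemma cd_conj_nth: "k < 2 ^ r \<Longrightarrow> cd_conj r z k = (if k = 0 then z 0 else - z k)"
  by (induction r arbitrary: z k) (auto simp: cd_pair_def cd_fst_def cd_snd_def)

lemma cd_conj_linear:
  "cd_conj r (\<lambda>k. a * x k + b * y k) = (\<lambda>k. a * cd_conj r x k + b * cd_conj r y k)"
proof (induction r arbitrary: x y)
  case (Suc r)
  have "cd_fst r (\<lambda>k. a * x k + b * y k) = (\<lambda>k. a * cd_fst r x k + b * cd_fst r y k)"
    "cd_snd r (\<lambda>k. a * x k + b * y k) = (\<lambda>k. a * cd_snd r x k + b * cd_snd r y k)"
    by (auto simp: cd_fst_def cd_snd_def)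
  then show ?case
    by (auto simp: Suc cd_pair_def algebra_simps)
qed simp

lemma cd_Re_eq: "cd_Re r z = z 0"
  by (simp add: cd_Re_def cd_conj_nth)

text \<open>Coordinates from 2^r on do not influence a product. This allows the conjugate of y to be
  replaced by 2 Re(y) - y, an identity that is available only below 2^r.\<close>

lemma cd_mult_cong:
  assumes "\<And>k. k < 2 ^ r \<Longrightarrow> x k = x' k" "\<And>k. k < 2 ^ r \<Longrightarrow> y k = y' k"
  shows "cd_mult r x y = cd_mult r x' y'"
proof (cases r)
  case (Suc q)
  have "cd_fst q x = cd_fst q x'" "cd_snd q x = cd_snd q x'"
    "cd_fst q y = cd_fst q y'" "cd_snd q y = cd_snd q y'"
    using assms Suc by (auto simp: cd_fst_def cd_snd_def)
  then show ?thesis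
    using Suc by simp
qed (use assms in auto)

lemma cd_mult_linear_left:
  "cd_mult r (\<lambda>k. a * x k + b * x' k) y = (\<lambda>k. a * cd_mult r x y k + b * cd_mult r x' y k)"
  and cd_mult_linear_right:
  "cd_mult r y (\<lambda>k. a * x k + b * x' k) = (\<lambda>k. a * cd_mult r y x k + b * cd_mult r y x' k)"
proof (induction r arbitrary: x x' y)
  case 0
  { case 1 then show ?case by (auto simp: algebra_simps) }
  { case 2 then show ?case by (auto simp: algebra_simps) }
next
  case (Suc r)
  have *: "cd_fst r (\<lambda>k. a * x k + b * x' k) = (\<lambda>k. a * cd_fst r x k + b * cd_fst r x' k)"
    "cd_snd r (\<lambda>k. a * x k + b * x' k) = (\<lambda>k. a * cd_snd r x k + b * cd_snd r x' k)" for x x'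
    by (auto simp: cd_fst_def cd_snd_def)
  { case 1 then show ?case
      by (simp add: * Suc Let_def cd_conj_linear) (simp add: cd_pair_def fun_eq_iff algebra_simps) }
  { case 2 then show ?case
      by (simp add: * Suc Let_def cd_conj_linear) (simp add: cd_pair_def fun_eq_iff algebra_simps) }
qed

lemma cd_mult_unit_right: "k < 2 ^ r \<Longrightarrow> cd_mult r x (cd_unit 0) k = x k"
  and cd_mult_unit_left: "k < 2 ^ r \<Longrightarrow> cd_mult r (cd_unit 0) x k = x k"
proof (induction r arbitrary: x k)
  case 0
  { case 1 then show ?case by (simp add: cd_unit_def) }
  { case 2 then show ?case by (simp add: cd_unit_def) }
next
  case (Suc r)
  have *: "cd_fst r (cd_unit 0) = cd_unit 0" "cd_snd r (cd_unit 0) = (\<lambda>_. 0)"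
    by (auto simp: cd_fst_def cd_snd_def cd_unit_def)
  have z: "cd_mult r x (\<lambda>_. 0) = (\<lambda>_. 0)" "cd_mult r (\<lambda>_. 0) x = (\<lambda>_. 0)" for x
    using cd_mult_linear_left[of r 0 x 0 x x] cd_mult_linear_right[of r x 0 x 0 x] by auto
  have c0: "cd_conj r (\<lambda>_. 0) = (\<lambda>_. 0)"
    using cd_conj_linear[of r 0 "\<lambda>_. 0" 0 "\<lambda>_. 0"] by auto
  have c: "cd_mult r x (cd_conj r (cd_unit 0)) = cd_mult r x (cd_unit 0)" for x
    by (rule cd_mult_cong) (auto simp: cd_conj_nth cd_unit_def)
  { case 1 then show ?case
      by (auto simp: * Let_def z c c0 cd_pair_def Suc) (auto simp: cd_fst_def cd_snd_def) }
  { case 2 then show ?case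
      by (auto simp: * Let_def z c c0 cd_pair_def Suc) (auto simp: cd_fst_def cd_snd_def) }
qed

text \<open>This is x^2 = 2 Re(x) x - |x|^2, proved along the doubling. Replacing conjugates by 2 Re
  - id turns the first half into \<xi>^2 + \<eta>^2 - 2 Re(\<eta>) \<eta>, where the induction
  hypothesis applies to both squares, and the second half into 2 Re(\<xi>) \<eta>. Associativity
  never enters.\<close>

lemma cd_mult_self:
  "k < 2 ^ r \<Longrightarrow>
    cd_mult r x x k = 2 * x 0 * x k - (if k = 0 then \<Sum>l<2 ^ r. (x l)\<^sup>2 else 0)"
proof (induction r arbitrary: x k)
  case 0
  then show ?case by (simp add: power2_eq_square)
next
  case (Suc r)
  define \<xi> where "\<xi> = cd_fst r x"
  define \<eta> where "\<eta> = cd_snd r x"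
  have conj: "cd_mult r (cd_conj r y) z = cd_mult r (\<lambda>k. 2 * y 0 * cd_unit 0 k + (-1) * y k) z"
    "cd_mult r z (cd_conj r y) = cd_mult r z (\<lambda>k. 2 * y 0 * cd_unit 0 k + (-1) * y k)" for y z
    by (rule cd_mult_cong; auto simp: cd_conj_nth cd_unit_def)+
  have "{..<2 ^ Suc r} = {..<2 ^ r} \<union> (\<lambda>k. 2 ^ r + k) ` {..<2 ^ r :: nat}"
  proof (intro set_eqI iffI)
    fix q :: nat assume "q \<in> {..<2 ^ Suc r}"
    then show "q \<in> {..<2 ^ r} \<union> (\<lambda>k. 2 ^ r + k) ` {..<2 ^ r}"
      by (cases "q < 2 ^ r") (auto intro!: image_eqI[of _ _ "q - 2 ^ r"])
  qed auto
  then have sum: "(\<Sum>l<2 ^ Suc r. (x l)\<^sup>2) = (\<Sum>l<2 ^ r. (\<xi> l)\<^sup>2) + (\<Sum>l<2 ^ r. (\<eta> l)\<^sup>2)"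
    by (simp only:) (subst sum.union_disjoint,
      auto simp: sum.reindex \<xi>_def \<eta>_def cd_fst_def cd_snd_def)
  show ?case
  proof (cases "k < 2 ^ r")
    case True
    then have "cd_mult (Suc r) x x k = cd_mult r \<xi> \<xi> k - cd_mult r (cd_conj r \<eta>) \<eta> k"
      by (simp add: Let_def cd_pair_def \<xi>_def \<eta>_def)
    also have "\<dots> = 2 * \<xi> 0 * \<xi> k - (if k = 0 then \<Sum>l<2 ^ Suc r. (x l)\<^sup>2 else 0)"
      using True unfolding conj sum
      by (subst cd_mult_linear_left) (simp add: Suc.IH cd_mult_unit_left)
    finally show ?thesis
      using True by (simp add: \<xi>_def cd_fst_def)
  next
    case False
    then have k: "k - 2 ^ r < 2 ^ r"
      using Suc.prems by simp
    have "cd_mult (Suc r) x x k = cd_mult r \<eta> \<xi> (k - 2 ^ r) + cd_mult r \<eta> (cd_conj r \<xi>) (k - 2 ^ r)"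
      using False by (simp add: Let_def cd_pair_def \<xi>_def \<eta>_def)
    also have "\<dots> = 2 * \<xi> 0 * \<eta> (k - 2 ^ r)"
      using k unfolding conj
      by (subst cd_mult_linear_right) (simp add: cd_mult_unit_right)
    also have "\<eta> (k - 2 ^ r) = x k"
      using False k by (simp add: \<eta>_def cd_snd_def)
    also have "\<xi> 0 = x 0"
      by (simp add: \<xi>_def cd_fst_def)
    finally have "cd_mult (Suc r) x x k = 2 * x 0 * x k" .
    moreover have "k \<noteq> 0"
      using False by (cases k) auto
    ultimately show ?thesis by (simp del: cd_mult.simps)
  qed
qed

text \<open>The structure constants do not depend on \<open>x\<close> and \<open>y\<close>, so
  integrals and derivatives of a product reduce to those of the real products
  \<open>x a * y b\<close>.\<close>

lemma cd_mult_eq_sum: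
  "cd_mult r x y i =
    (\<Sum>a<2 ^ r. \<Sum>b<2 ^ r. cd_mult r (cd_unit a) (cd_unit b) i * (x a * y b))"
proof -
  have z: "cd_mult r y (\<lambda>_. 0) = (\<lambda>_. 0)" "cd_mult r (\<lambda>_. 0) y = (\<lambda>_. 0)" for y
    using cd_mult_linear_left[of r 0 y 0 y y] cd_mult_linear_right[of r y 0 y 0 y] by auto
  have left: "cd_mult r (\<lambda>k. \<Sum>a\<in>A. x a * cd_unit a k) y i = (\<Sum>a\<in>A. x a * cd_mult r (cd_unit a) y i)"
    if "finite A" for A and x y :: cd
    using that
  proof (induction A)
    case (insert a A)
    then show ?case
      using cd_mult_linear_left[of r "x a" "cd_unit a" 1 "\<lambda>k. \<Sum>a\<in>A. x a * cd_unit a k" y] by simp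
  qed (simp add: z)
  have right: "cd_mult r y (\<lambda>k. \<Sum>a\<in>A. x a * cd_unit a k) i = (\<Sum>a\<in>A. x a * cd_mult r y (cd_unit a) i)"
    if "finite A" for A and x y :: cd
    using that
  proof (induction A)
    case (insert a A)
    then show ?case
      using cd_mult_linear_right[of r y "x a" "cd_unit a" 1 "\<lambda>k. \<Sum>a\<in>A. x a * cd_unit a k"] by simp
  qed (simp add: z)
  have expand: "(\<Sum>a<2 ^ r. x a * cd_unit a k) = x k" if "k < 2 ^ r" for k and x :: cd
    using that by (simp add: cd_unit_def if_distrib[of "(*) _"] cong: if_cong)
  have "cd_mult r x y =
      cd_mult r (\<lambda>k. \<Sum>a<2 ^ r. x a * cd_unit a k) (\<lambda>k. \<Sum>b<2 ^ r. y b * cd_unit b k)"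
    by (rule cd_mult_cong) (simp_all add: expand)
  then show ?thesis
    by (simp add: left right sum_distrib_left mult_ac)
qed

lemma cd_norm_eq: "cd_norm r z = sqrt (\<Sum>k<2 ^ r. (z k)\<^sup>2)"
proof -
  have "cd_mult r z (cd_conj r z) = cd_mult r z (\<lambda>k. 2 * z 0 * cd_unit 0 k + (-1) * z k)"
    by (rule cd_mult_cong; auto simp: cd_conj_nth cd_unit_def)
  then show ?thesis
    unfolding cd_norm_def
    by (subst (asm) cd_mult_linear_right) (simp add: cd_mult_unit_right cd_mult_self)
qed

lemma abs_nth_le_cd_norm: "k < 2 ^ r \<Longrightarrow> \<bar>z k\<bar> \<le> cd_norm r z"
  unfolding cd_norm_eq
  by (rule real_le_rsqrt) (auto intro: member_le_sum)

lemma lessThan_two_power: "{..<2 ^ r :: nat} = insert 0 {1..2 ^ r - 1}"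
proof -
  have "{..<N} = insert 0 {1..N - 1}" if "0 < N" for N :: nat
    using that by auto
  then show ?thesis by simp
qed

text \<open>A power of \<open>z\<close> lies in the plane spanned by \<open>1\<close> and the imaginary part of \<open>z\<close>, which is
  a copy of the complex plane.\<close>

lemma cd_power_nth:
  assumes "k < 2 ^ r" and "\<rho>\<^sup>2 = (\<Sum>l = 1..2 ^ r - 1. (z l)\<^sup>2)"
  shows "\<rho> * cd_power r z q k =
    (if k = 0 then \<rho> * Re (Complex (z 0) \<rho> ^ q) else Im (Complex (z 0) \<rho> ^ q) * z k)"
    (is "?lhs q k = ?rhs q k")
proof -
  have sq: "(\<Sum>l<2 ^ r. (z l)\<^sup>2) = (z 0)\<^sup>2 + \<rho>\<^sup>2"
    unfolding lessThan_two_power assms(2) by (subst sum.insert) auto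
  define v where "v = (\<lambda>k. if k = 0 then 0 else z k)"
  have "\<forall>k<2 ^ r. ?lhs q k = ?rhs q k"
  proof (induction q)
    case (Suc q)
    define w where "w = Complex (z 0) \<rho> ^ q"
    \<comment> \<open>By induction the scaled power is a real combination of 1 and z, so the next
      one involves only z times 1 and z times z, with no rebracketing. The summand
      \<open>0 * z k\<close> gives the left side the shape of the linearity rule.\<close>
    have "cd_mult r z (\<lambda>k. \<rho> * cd_power r z q k + 0 * z k) =
        cd_mult r z (\<lambda>k. (\<rho> * Re w - z 0 * Im w) * cd_unit 0 k + Im w * z k)"
      by (rule cd_mult_cong) (use Suc in \<open>auto simp: cd_unit_def w_def algebra_simps\<close>)
    then have "\<rho> * cd_power r z (Suc q) k =
        (\<rho> * Re w - z 0 * Im w) * cd_mult r z (cd_unit 0) k + Im w * cd_mult r z z k" for k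
      unfolding cd_mult_linear_right fun_eq_iff by simp
    then show ?case
      by (simp add: cd_mult_unit_right cd_mult_self sq flip: w_def)
         (simp add: algebra_simps power2_eq_square)
  qed (simp add: cd_unit_def)
  then show ?thesis using assms(1) by blast
qed

text \<open>Comparison with the exponential series of the complex number z_0 + i \<rho>. Only
  \<rho>^2 is prescribed, so \<rho> may be negative, in accordance with cos \<rho> and sin \<rho> /
  \<rho> being even; this allows \<rho> to be the first phase in the spherical case.\<close>

lemma cd_exp_nth:
  assumes k: "k < 2 ^ r" and \<rho>: "\<rho>\<^sup>2 = (\<Sum>l = 1..2 ^ r - 1. (z l)\<^sup>2)"
  shows "cd_exp r z k =
    exp (z 0) * (if k = 0 then cos \<rho> else (if \<rho> = 0 then 0 else sin \<rho> / \<rho> * z k))"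
proof -
  define w where "w = Complex (z 0) \<rho>"
  have "(\<lambda>q. w ^ q /\<^sub>R fact q) sums exp w"
    by (rule exp_converges)
  then have Re: "(\<lambda>q. Re (w ^ q) / fact q) sums (exp (z 0) * cos \<rho>)"
    and Im: "(\<lambda>q. Im (w ^ q) / fact q) sums (exp (z 0) * sin \<rho>)"
    by (auto dest: sums_Re sums_Im simp: w_def Re_exp Im_exp divide_inverse mult.commute)
  show ?thesis
  proof (cases "\<rho> = 0")
    case False
    then have "cd_power r z q k / fact q =
        (if k = 0 then Re (w ^ q) / fact q else Im (w ^ q) / fact q * (z k / \<rho>))" for q
      using cd_power_nth[OF k \<rho>, of q] by (auto simp: field_simps w_def)
    then have "cd_exp r z k =
        (if k = 0 then exp (z 0) * cos \<rho> else exp (z 0) * sin \<rho> * (z k / \<rho>))"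
      unfolding cd_exp_def using sums_unique[OF Re] sums_unique[OF sums_mult2[OF Im, of "z k / \<rho>"]]
      by (cases "k = 0") simp_all
    then show ?thesis using False by simp
  next
    case True
    then have z: "z l = 0" if "l \<in> {1..2 ^ r - 1}" for l
      using \<rho> that by (simp add: sum_nonneg_eq_0_iff)
    have z': "z l = z 0 * cd_unit 0 l" if "l < 2 ^ r" for l
    proof -
      have "l = 0 \<or> l \<in> {1..2 ^ r - 1}"
        using that lessThan_two_power[of r] by blast
      then show ?thesis
        using z[of l] unfolding cd_unit_def by (elim disjE) simp_all
    qed
    have "\<forall>k<2 ^ r. cd_power r z q k = z 0 ^ q * cd_unit 0 k" for q
    proof (induction q)
      case (Suc q)
      have "cd_power r z (Suc q) = cd_mult r (\<lambda>l. z 0 * cd_unit 0 l + 0 * cd_unit 0 l) (cd_power r z q)"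
        unfolding cd_power.simps by (rule cd_mult_cong) (drule z', linarith, rule refl)
      then show ?case using Suc unfolding cd_mult_linear_left by (simp add: cd_mult_unit_left)
    qed simp
    then have "cd_exp r z k = (\<Sum>q. z 0 ^ q / fact q * cd_unit 0 k)"
      unfolding cd_exp_def by (intro suminf_cong) (simp add: k)
    also have "\<dots> = exp (z 0) * cd_unit 0 k"
      using sums_mult2[OF exp_converges[of "z 0"], of "cd_unit 0 k"]
      by (intro sums_unique[symmetric]) (simp add: field_simps)
    finally show ?thesis
      using True by (simp add: cd_unit_def)
  qed
qed

section \<open>Subexponential functions with subexponential derivatives\<close>

text \<open>The derivatives of the entire function \<open>y \<mapsto> cos \<surd>y\<close>.\<close>

definition cos_root :: "nat \<Rightarrow> real \<Rightarrow> real" where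
  "cos_root m y = (\<Sum>n. (diffs ^^ m) (\<lambda>n. (- 1) ^ n / fact (2 * n)) n * y ^ n)"

text \<open>The coefficients are dominated by those of the exponential series since n! \<le> (2n)!,
  and termwise differentiation preserves convergence everywhere.\<close>

lemma summable_cos_root:
  "summable (\<lambda>n. (diffs ^^ m) (\<lambda>n. (- 1) ^ n / fact (2 * n)) n * y ^ n)" for y :: real
proof (induction m arbitrary: y)
  case 0
  have "norm ((- 1) ^ n / fact (2 * n) * y ^ n) \<le> inverse (fact n) * \<bar>y\<bar> ^ n" for n
  proof -
    have "(fact n :: real) \<le> fact (2 * n)"
      by (rule fact_mono) simp
    then show ?thesis
      by (simp add: abs_mult power_abs divide_inverse le_imp_inverse_le mult_right_mono)
  qed
  then show ?case
    using summable_exp[of "\<bar>y\<bar>"] by (auto intro: summable_comparison_test')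
next
  case (Suc m)
  then show ?case
    using termdiff_converges_all[of "(diffs ^^ m) (\<lambda>n. (- 1) ^ n / fact (2 * n))" y] by simp
qed

lemma DERIV_cos_root: "(cos_root m has_real_derivative cos_root (Suc m) y) (at y)"
  unfolding cos_root_def[abs_def] funpow.simps o_apply
  by (rule termdiffs_strong_converges_everywhere) (rule summable_cos_root)

lemma continuous_on_cos_root: "continuous_on A (cos_root m)"
  using DERIV_cos_root by (meson DERIV_isCont continuous_at_imp_continuous_on)

lemma cos_root_0_power2: "cos_root 0 (x\<^sup>2) = cos x"
proof -
  have "(\<lambda>n. (- 1) ^ n / fact (2 * n) * x ^ (2 * n)) sums cos x"
    using cos_paired[of x] by simp
  then show ?thesis
    by (auto simp: cos_root_def power_mult intro: sums_unique[symmetric])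
qed

text \<open>The chain rule for cos \<surd>y at y = x^2. It makes 2 \<open>cos_root 1\<close> at x^2
  a smooth substitute for - sin x / x.\<close>

lemma cos_root_1_power2: "2 * x * cos_root 1 (x\<^sup>2) = - sin x"
proof -
  have "((\<lambda>x. cos_root 0 (x\<^sup>2)) has_real_derivative cos_root 1 (x\<^sup>2) * (2 * x)) (at x)"
    by (rule DERIV_chain2[where g = "\<lambda>x. x\<^sup>2"])
       (auto intro!: derivative_eq_intros DERIV_cos_root[of 0, simplified])
  then have "cos_root 1 (x\<^sup>2) * (2 * x) = - sin x"
    unfolding cos_root_0_power2 using DERIV_cos DERIV_unique by blast
  then show ?thesis by (simp add: mult_ac)
qed

text \<open>The differential equation \<open>4 y g'' + 2 g' + g = 0\<close> of \<open>g(y) = cos \<surd>y\<close>, differentiated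
  \<open>m\<close> times.\<close>

lemma cos_root_ode:
  "4 * y * cos_root (Suc (Suc m)) y + (4 * real m + 2) * cos_root (Suc m) y + cos_root m y = 0"
proof (induction m arbitrary: y)
  case 0
  define c :: "nat \<Rightarrow> real" where "c = (\<lambda>n. (- 1) ^ n / fact (2 * n))"
  have sums: "(\<lambda>n. (diffs ^^ m) c n * y ^ n) sums cos_root m y" for m
    unfolding cos_root_def c_def by (rule summable_sums[OF summable_cos_root])
  have "(\<lambda>n. diffs (diffs c) n * y ^ Suc n) sums (y * cos_root 2 y)"
    using sums_mult[OF sums[of 2], of y] by (simp add: numeral_2_eq_2 mult_ac)
  \<comment> \<open>Multiplication by y shifts the coefficients by one, with 0 in degree 0; now the
    three series can be added term by term.\<close>
  then have "(\<lambda>n. (if n = 0 then 0 else diffs (diffs c) (n - 1)) * y ^ n) sums (y * cos_root 2 y)"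
    using sums_Suc_iff[where f = "\<lambda>n. (if n = 0 then 0 else diffs (diffs c) (n - 1)) * y ^ n"]
    by (simp del: power_Suc)
  from sums_add[OF sums_add[OF sums_mult[OF this, of 4] sums_mult[OF sums[of 1], of 2]] sums[of 0]]
  have "(\<lambda>n. (4 * (if n = 0 then 0 else diffs (diffs c) (n - 1)) + 2 * diffs c n + c n) * y ^ n) sums
      (4 * y * cos_root 2 y + 2 * cos_root 1 y + cos_root 0 y)"
    by (simp add: algebra_simps)
  moreover have "4 * (if n = 0 then 0 else diffs (diffs c) (n - 1)) + 2 * diffs c n + c n = 0" for n
  proof -
    have "4 * (if n = 0 then 0 else diffs (diffs c) (n - 1)) + 2 * diffs c n =
        (2 * n + 1) * (2 * n + 2) * c (Suc n)"
      by (cases n) (simp_all add: diffs_def algebra_simps)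
    also have "\<dots> = - c n"
      by (simp add: c_def divide_simps) (simp add: algebra_simps)
    finally show ?thesis by simp
  qed
  ultimately have "4 * y * cos_root 2 y + 2 * cos_root 1 y + cos_root 0 y = 0"
    using sums_unique2[OF _ sums_zero] by simp
  then show ?case by (simp add: numeral_2_eq_2)
next
  case (Suc m)
  have "((\<lambda>y. 4 * y * cos_root (Suc (Suc m)) y + (4 * real m + 2) * cos_root (Suc m) y + cos_root m y)
      has_real_derivative
        4 * y * cos_root (Suc (Suc (Suc m))) y + (4 * real (Suc m) + 2) * cos_root (Suc (Suc m)) y
          + cos_root (Suc m) y) (at y)"
    by (auto intro!: derivative_eq_intros DERIV_cos_root simp: algebra_simps)
  then show ?case
    unfolding Suc by (rule DERIV_unique) (rule DERIV_const)
qed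

text \<open>Compactness covers [0, 1]. For y \<ge> 1 the cases m = 0, 1 are cos \<surd>y and - sin
  \<surd>y / (2 \<surd>y); for larger m the differential equation is solved for its leading term,
  whose factor 4 y is at least 1. On the negative axis the function is a hyperbolic cosine, hence
  the restriction to y \<ge> 0.\<close>

lemma cos_root_bounded: "\<exists>B. \<forall>y\<ge>0. \<bar>cos_root m y\<bar> \<le> B"
proof (induction m rule: less_induct)
  case (less m)
  have "compact (cos_root m ` {0..1})"
    by (intro compact_continuous_image continuous_on_cos_root) simp
  then obtain B0 where B0: "\<And>y. y \<in> {0..1} \<Longrightarrow> \<bar>cos_root m y\<bar> \<le> B0"
    by (meson bounded_real compact_imp_bounded image_eqI)
  have "\<exists>B. \<forall>y\<ge>1. \<bar>cos_root m y\<bar> \<le> B"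
  proof (cases "m < 2")
    case True
    have "\<bar>cos_root m y\<bar> \<le> 1" if "1 \<le> y" for y
    proof -
      have y: "y = (sqrt y)\<^sup>2" "1 \<le> sqrt y" using that by auto
      have "m = 0 \<or> m = 1" using True by auto
      then show ?thesis
      proof
        assume "m = 1"
        have "1 * \<bar>cos_root 1 y\<bar> \<le> 2 * sqrt y * \<bar>cos_root 1 y\<bar>"
          using y(2) by (intro mult_right_mono) linarith+
        also have "\<dots> = \<bar>2 * sqrt y * cos_root 1 ((sqrt y)\<^sup>2)\<bar>"
          using that by (simp add: abs_mult)
        also have "\<dots> \<le> 1" unfolding cos_root_1_power2 by simp
        finally show ?thesis using \<open>m = 1\<close> by simp
      next
        assume "m = 0"
        then show ?thesis using cos_root_0_power2[of "sqrt y"] that by simp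
      qed
    qed
    then show ?thesis by blast
  next
    case False
    then obtain q where q: "m = Suc (Suc q)" by (metis add_2_eq_Suc le_Suc_ex not_less)
    obtain B1 B2 where B1: "\<And>y. y \<ge> 0 \<Longrightarrow> \<bar>cos_root q y\<bar> \<le> B1"
      and B2: "\<And>y. y \<ge> 0 \<Longrightarrow> \<bar>cos_root (Suc q) y\<bar> \<le> B2"
      using less[of q] less[of "Suc q"] q by auto
    have "\<bar>cos_root m y\<bar> \<le> (4 * real q + 2) * B2 + B1" if "1 \<le> y" for y
    proof -
      have "1 * \<bar>cos_root m y\<bar> \<le> (4 * y) * \<bar>cos_root m y\<bar>"
        using that by (intro mult_right_mono) auto
      also have "\<dots> = \<bar>- ((4 * real q + 2) * cos_root (Suc q) y + cos_root q y)\<bar>"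
      proof -
        have "(4 * y) * cos_root m y = - ((4 * real q + 2) * cos_root (Suc q) y + cos_root q y)"
          using cos_root_ode[of y q] unfolding q by linarith
        moreover have "\<bar>4 * y\<bar> = 4 * y" using that by simp
        ultimately show ?thesis by (metis abs_mult)
      qed
      also have "\<dots> \<le> \<bar>(4 * real q + 2) * cos_root (Suc q) y\<bar> + \<bar>cos_root q y\<bar>" by linarith
      also have "\<dots> \<le> (4 * real q + 2) * B2 + B1"
        unfolding abs_mult using B1[of y] B2[of y] that
        by (intro add_mono mult_mono) auto
      finally show ?thesis by simp
    qed
    then show ?thesis by blast
  qed
  then obtain B3 where "\<And>y. y \<ge> 1 \<Longrightarrow> \<bar>cos_root m y\<bar> \<le> B3" by blast
  with B0 have "\<bar>cos_root m y\<bar> \<le> max B0 B3" if "0 \<le> y" for y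
    using that by (cases "y \<le> 1") (auto simp: le_max_iff_disj)
  then show ?case by blast
qed

inductive tempered :: "nat \<Rightarrow> (cd \<Rightarrow> real) \<Rightarrow> bool" for n where
  const: "tempered n (\<lambda>_. c)"
| coord: "k \<in> {1..n} \<Longrightarrow> tempered n (\<lambda>\<psi>. \<psi> k)"
| sin: "tempered n (\<lambda>\<psi>. sin (\<psi> k))"
| cos: "tempered n (\<lambda>\<psi>. cos (\<psi> k))"
| cos_root: "tempered n (\<lambda>\<psi>. cos_root m (\<Sum>l = 1..n. (\<psi> l)\<^sup>2))"
| add: "tempered n \<Phi> \<Longrightarrow> tempered n \<Psi> \<Longrightarrow> tempered n (\<lambda>\<psi>. \<Phi> \<psi> + \<Psi> \<psi>)"
| mult: "tempered n \<Phi> \<Longrightarrow> tempered n \<Psi> \<Longrightarrow> tempered n (\<lambda>\<psi>. \<Phi> \<psi> * \<Psi> \<psi>)"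

lemma tempered_if:
  "\<lbrakk>c \<Longrightarrow> tempered n \<Phi>; \<not> c \<Longrightarrow> tempered n \<Psi>\<rbrakk> \<Longrightarrow> tempered n (\<lambda>\<psi>. if c then \<Phi> \<psi> else \<Psi> \<psi>)"
  by (cases c) simp_all

lemma tempered_prod:
  assumes "finite A" "\<And>l. l \<in> A \<Longrightarrow> tempered n (\<Phi> l)"
  shows "tempered n (\<lambda>\<psi>. \<Prod>l\<in>A. \<Phi> l \<psi>)"
  using assms by (induction A) (auto intro: tempered.intros)

text \<open>A relation instead of an operator: it includes existence of the derivative at every
  point of each coordinate line, as the chain rule and differentiation under the integral
  require.\<close>

definition partial_of :: "nat \<Rightarrow> (cd \<Rightarrow> real) \<Rightarrow> (cd \<Rightarrow> real) \<Rightarrow> bool" where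
  "partial_of k \<Phi> \<Phi>' \<longleftrightarrow>
    (\<forall>\<psi> x. ((\<lambda>x. \<Phi> (\<psi>(k := x))) has_real_derivative \<Phi>' (\<psi>(k := x))) (at x))"

lemma tempered_partial:
  assumes "tempered n \<Phi>" "k \<in> {1..n}"
  shows "\<exists>\<Phi>'. tempered n \<Phi>' \<and> partial_of k \<Phi> \<Phi>'"
  using assms(1)
proof induction
  case (const c)
  then show ?case
    unfolding partial_of_def by (intro exI[of _ "\<lambda>_. 0"]) (auto intro: tempered.intros)
next
  case (coord l)
  show ?case
    unfolding partial_of_def
    by (intro exI[of _ "\<lambda>_. if l = k then 1 else 0"]) (auto intro!: tempered.intros derivative_eq_intros)
next
  case (sin l)
  have "tempered n (\<lambda>\<psi>. (if l = k then 1 else 0) * cos (\<psi> l))"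
    by (intro tempered.intros)
  moreover have "partial_of k (\<lambda>\<psi>. sin (\<psi> l)) (\<lambda>\<psi>. (if l = k then 1 else 0) * cos (\<psi> l))"
    unfolding partial_of_def by (auto intro!: derivative_eq_intros)
  ultimately show ?case by blast
next
  case (cos l)
  have "tempered n (\<lambda>\<psi>. (if l = k then -1 else 0) * sin (\<psi> l))"
    by (intro tempered.intros)
  moreover have "partial_of k (\<lambda>\<psi>. cos (\<psi> l)) (\<lambda>\<psi>. (if l = k then -1 else 0) * sin (\<psi> l))"
    unfolding partial_of_def by (auto intro!: derivative_eq_intros)
  ultimately show ?case by blast
next
  case (cos_root m)
  have sum: "(\<Sum>l = 1..n. ((\<psi>(k := x)) l)\<^sup>2) = (\<Sum>l\<in>{1..n} - {k}. (\<psi> l)\<^sup>2) + x\<^sup>2" for \<psi> and x :: real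
    using assms(2) by (subst sum.remove[of _ k]) auto
  have "((\<lambda>x. cos_root m (s + x\<^sup>2)) has_real_derivative 2 * x * cos_root (Suc m) (s + x\<^sup>2)) (at x)" for s x
    by (rule DERIV_cong[OF DERIV_chain2[where g = "\<lambda>x. s + x\<^sup>2", OF DERIV_cos_root]])
       (auto intro!: derivative_eq_intros)
  then have "partial_of k (\<lambda>\<psi>. cos_root m (\<Sum>l = 1..n. (\<psi> l)\<^sup>2))
      (\<lambda>\<psi>. (2 * \<psi> k) * cos_root (Suc m) (\<Sum>l = 1..n. (\<psi> l)\<^sup>2))"
    unfolding partial_of_def sum by simp
  moreover have "tempered n (\<lambda>\<psi>. (2 * \<psi> k) * cos_root (Suc m) (\<Sum>l = 1..n. (\<psi> l)\<^sup>2))"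
    using assms(2) by (intro tempered.intros)
  ultimately show ?case by blast
next
  case (add \<Phi> \<Psi>)
  then obtain \<Phi>' \<Psi>' where "tempered n \<Phi>'" "tempered n \<Psi>'" "partial_of k \<Phi> \<Phi>'" "partial_of k \<Psi> \<Psi>'"
    by blast
  then show ?case
    unfolding partial_of_def
    by (intro exI[of _ "\<lambda>\<psi>. \<Phi>' \<psi> + \<Psi>' \<psi>"]) (auto intro!: tempered.intros derivative_eq_intros)
next
  case (mult \<Phi> \<Psi>)
  then obtain \<Phi>' \<Psi>' where "tempered n \<Phi>'" "tempered n \<Psi>'" "partial_of k \<Phi> \<Phi>'" "partial_of k \<Psi> \<Psi>'"
    by blast
  with mult show ?case
    unfolding partial_of_def
    by (intro exI[of _ "\<lambda>\<psi>. \<Phi>' \<psi> * \<Psi> \<psi> + \<Phi> \<psi> * \<Psi>' \<psi>"])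
       (auto intro!: tempered.intros derivative_eq_intros)
qed

text \<open>The rate \<delta> varies in the induction, since a product gives half of it to each
  factor. A coordinate uses x \<le> exp(\<delta> x) / \<delta>; every other generator is
  bounded.\<close>

lemma tempered_subexp:
  assumes "tempered n \<Phi>" "0 < \<delta>"
  shows "\<exists>C\<ge>0. \<forall>\<psi>. \<bar>\<Phi> \<psi>\<bar> \<le> C * exp (\<delta> * (\<Sum>k = 1..n. \<bar>\<psi> k\<bar>))"
proof -
  have bounded: "\<exists>C\<ge>0. \<forall>\<psi>. \<bar>\<Phi> \<psi>\<bar> \<le> C * exp (\<delta> * (\<Sum>k = 1..n. \<bar>\<psi> k\<bar>))"
    if "\<And>\<psi>. \<bar>\<Phi> \<psi>\<bar> \<le> C" "0 < \<delta>" for \<Phi> :: "cd \<Rightarrow> real" and C \<delta>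
  proof (intro exI[of _ C] conjI allI)
    show C: "0 \<le> C" using that(1)[of "\<lambda>_. 0"] by linarith
    fix \<psi> :: cd
    have "0 \<le> \<delta> * (\<Sum>k = 1..n. \<bar>\<psi> k\<bar>)" using that(2) by (simp add: sum_nonneg)
    then have "C * 1 \<le> C * exp (\<delta> * (\<Sum>k = 1..n. \<bar>\<psi> k\<bar>))"
      using C by (intro mult_left_mono) auto
    then show "\<bar>\<Phi> \<psi>\<bar> \<le> C * exp (\<delta> * (\<Sum>k = 1..n. \<bar>\<psi> k\<bar>))"
      using that(1)[of \<psi>] by linarith
  qed
  show ?thesis
    using assms
  proof (induction arbitrary: \<delta>)
    case (const c)
    then show ?case by (intro bounded[of _ "\<bar>c\<bar>"]) auto
  next
    case (coord l)
    have "\<bar>\<psi> l\<bar> \<le> 1 / \<delta> * exp (\<delta> * (\<Sum>k = 1..n. \<bar>\<psi> k\<bar>))" for \<psi> :: cd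
    proof -
      have "\<bar>\<psi> l\<bar> \<le> (\<Sum>k = 1..n. \<bar>\<psi> k\<bar>)"
        using coord by (intro member_le_sum) auto
      then have "\<delta> * \<bar>\<psi> l\<bar> \<le> \<delta> * (\<Sum>k = 1..n. \<bar>\<psi> k\<bar>)"
        using coord by (intro mult_left_mono) auto
      also have "\<dots> \<le> exp (\<delta> * (\<Sum>k = 1..n. \<bar>\<psi> k\<bar>))"
        using exp_ge_add_one_self[of "\<delta> * (\<Sum>k = 1..n. \<bar>\<psi> k\<bar>)"] by linarith
      finally show ?thesis
        using coord by (simp add: field_simps)
    qed
    then show ?case using coord by (intro exI[of _ "1 / \<delta>"]) auto
  next
    case (sin k)
    then show ?case by (intro bounded[of _ 1]) auto
  next
    case (cos k)
    then show ?case by (intro bounded[of _ 1]) auto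
  next
    case (cos_root m)
    obtain B where B: "\<And>y. y \<ge> 0 \<Longrightarrow> \<bar>cos_root m y\<bar> \<le> B"
      using cos_root_bounded by blast
    show ?case using cos_root by (intro bounded[of _ B] B sum_nonneg) simp_all
  next
    case (add \<Phi> \<Psi>)
    from add.IH[OF \<open>0 < \<delta>\<close>] obtain C D where
      C: "C \<ge> 0" "\<And>\<psi>. \<bar>\<Phi> \<psi>\<bar> \<le> C * exp (\<delta> * (\<Sum>k = 1..n. \<bar>\<psi> k\<bar>))" and
      D: "D \<ge> 0" "\<And>\<psi>. \<bar>\<Psi> \<psi>\<bar> \<le> D * exp (\<delta> * (\<Sum>k = 1..n. \<bar>\<psi> k\<bar>))" by blast
    have "\<bar>\<Phi> \<psi> + \<Psi> \<psi>\<bar> \<le> (C + D) * exp (\<delta> * (\<Sum>k = 1..n. \<bar>\<psi> k\<bar>))" for \<psi>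
      using C(2)[of \<psi>] D(2)[of \<psi>] by (simp add: algebra_simps)
    then show ?case using C(1) D(1) by (intro exI[of _ "C + D"]) auto
  next
    case (mult \<Phi> \<Psi>)
    from \<open>0 < \<delta>\<close> have "0 < \<delta> / 2" by simp
    from mult.IH[OF this] obtain C D where
      C: "C \<ge> 0" "\<And>\<psi>. \<bar>\<Phi> \<psi>\<bar> \<le> C * exp (\<delta> / 2 * (\<Sum>k = 1..n. \<bar>\<psi> k\<bar>))" and
      D: "D \<ge> 0" "\<And>\<psi>. \<bar>\<Psi> \<psi>\<bar> \<le> D * exp (\<delta> / 2 * (\<Sum>k = 1..n. \<bar>\<psi> k\<bar>))" by blast
    have "\<bar>\<Phi> \<psi> * \<Psi> \<psi>\<bar> \<le> (C * D) * exp (\<delta> * (\<Sum>k = 1..n. \<bar>\<psi> k\<bar>))" for \<psi>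
    proof -
      have "\<bar>\<Phi> \<psi> * \<Psi> \<psi>\<bar> \<le> (C * exp (\<delta> / 2 * (\<Sum>k = 1..n. \<bar>\<psi> k\<bar>))) * (D * exp (\<delta> / 2 * (\<Sum>k = 1..n. \<bar>\<psi> k\<bar>)))"
        unfolding abs_mult using C D by (intro mult_mono) auto
      also have "\<dots> = (C * D) * exp (\<delta> * (\<Sum>k = 1..n. \<bar>\<psi> k\<bar>))"
        by (simp flip: exp_add add: mult_ac)
      finally show ?thesis .
    qed
    then show ?case using C(1) D(1) by (intro exI[of _ "C * D"]) auto
  qed
qed

lemma tempered_measurable:
  assumes "tempered n \<Phi>" and \<psi>: "\<And>k. (\<lambda>t. \<psi> t k) \<in> borel_measurable M"
  shows "(\<lambda>t. \<Phi> (\<psi> t)) \<in> borel_measurable M"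
  using assms(1)
proof induction
  case (cos_root m)
  have "cos_root m \<in> borel_measurable borel"
    by (intro borel_measurable_continuous_onI continuous_on_cos_root)
  then show ?case using \<psi> by (auto intro!: measurable_compose[where N = borel])
qed (use \<psi> in auto)

section \<open>Integrals of exponentially decaying functions\<close>

lemma integrable_exp_minus_abs:
  assumes "0 < \<epsilon>"
  shows "integrable lborel (\<lambda>x::real. exp (- \<epsilon> * \<bar>x\<bar>))"
proof -
  define g where "g = (\<lambda>x::real. indicator {0..} x * exp (- \<epsilon> * x))"
  have [measurable]: "g \<in> borel_measurable borel"
    unfolding g_def by measurable
  have "(\<lambda>x. exp (- \<epsilon> * x)) absolutely_integrable_on {0..}"
    using integrable_on_exp_minus_to_infinity[OF assms]
    by (intro nonnegative_absolutely_integrable_1) auto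
  then have "integrable lborel g"
    unfolding set_integrable_def g_def by (simp add: integrable_completion)
  \<comment> \<open>Adding the reflection of the half-line function gives a majorant on the whole
    line; at 0 it takes the value 2 instead of 1.\<close>
  from Bochner_Integration.integrable_add[OF this lborel_integrable_real_affine[OF this, of "-1" 0]]
  have "integrable lborel (\<lambda>x. g x + g (- x))" by simp
  then show ?thesis
    by (rule Bochner_Integration.integrable_bound) (auto simp: g_def indicator_def)
qed

text \<open>In the sum norm the exponential factors over the coordinates, so the integral is a
  product of one-dimensional ones.\<close>

lemma integrable_exp_minus_sum_abs:
  assumes "0 < \<epsilon>"
  shows "integrable lebesgue (\<lambda>t::real ^ 'n::finite. exp (- \<epsilon> * (\<Sum>i\<in>UNIV. \<bar>t $ i\<bar>)))"
proof -
  have B: "(Basis :: (real ^ 'n) set) = range (\<lambda>i. axis i 1)"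
    by (auto simp: Basis_vec_def)
  have "(\<Sum>i\<in>UNIV. \<bar>t $ i\<bar>) = (\<Sum>b\<in>Basis. \<bar>t \<bullet> b\<bar>)" for t :: "real ^ 'n"
    unfolding B by (subst sum.reindex) (auto simp: inj_on_def axis_eq_axis cart_eq_inner_axis)
  then have *: "exp (- \<epsilon> * (\<Sum>i\<in>UNIV. \<bar>t $ i\<bar>)) = (\<Prod>b\<in>Basis. exp (- \<epsilon> * \<bar>t \<bullet> b\<bar>))" for t :: "real ^ 'n"
    by (simp add: exp_sum sum_distrib_left flip: sum_negf)
  have fin: "(\<integral>\<^sup>+ x. ennreal (exp (- \<epsilon> * \<bar>x\<bar>)) \<partial>lborel) < \<infinity>"
    using integrable_exp_minus_abs[OF assms] by (simp add: integrable_iff_bounded)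
  have "(\<integral>\<^sup>+ t. ennreal (\<Prod>b\<in>Basis. exp (- \<epsilon> * \<bar>t \<bullet> b\<bar>)) \<partial>(lborel :: (real ^ 'n) measure))
      = (\<integral>\<^sup>+ t. (\<Prod>b\<in>Basis. ennreal (exp (- \<epsilon> * \<bar>t \<bullet> b\<bar>))) \<partial>(lborel :: (real ^ 'n) measure))"
    by (simp add: prod_ennreal)
  also have "\<dots> = (\<Prod>b\<in>(Basis :: (real ^ 'n) set). \<integral>\<^sup>+ x. ennreal (exp (- \<epsilon> * \<bar>x\<bar>)) \<partial>lborel)"
    by (rule nn_integral_lborel_prod) auto
  also have "\<dots> < \<infinity>"
    using fin by (simp add: power_less_top_ennreal less_top)
  finally have "integrable lborel (\<lambda>t::real ^ 'n. \<Prod>b\<in>Basis. exp (- \<epsilon> * \<bar>t \<bullet> b\<bar>))"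
    by (intro integrableI_bounded) (auto simp: abs_prod)
  then show ?thesis
    unfolding * by (subst integrable_completion) auto
qed

section \<open>Translations and measurability for Lebesgue measure\<close>

lemma distr_translation_lebesgue: "distr lebesgue lebesgue ((+) a) = lebesgue"
  and measurable_translation_lebesgue: "(+) a \<in> lebesgue \<rightarrow>\<^sub>M lebesgue"
  for a :: "'a::euclidean_space"
proof -
  have *: "(\<lambda>x. a + (\<Sum>j\<in>Basis. (1 * (x \<bullet> j)) *\<^sub>R j)) = (+) a"
    by (simp add: euclidean_representation)
  show "distr lebesgue lebesgue ((+) a) = lebesgue"
    using lebesgue_affine_euclidean[of "\<lambda>_. 1" a] unfolding * by (simp add: density_1)
  show "(+) a \<in> lebesgue \<rightarrow>\<^sub>M lebesgue"
    using lebesgue_affine_measurable[of "\<lambda>_. 1" a] unfolding * by simp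
qed

lemma integral_translation_lebesgue:
  fixes f :: "'a::euclidean_space \<Rightarrow> real"
  assumes "f \<in> borel_measurable lebesgue"
  shows "(LINT t|lebesgue. f (a + t)) = (LINT t|lebesgue. f t)"
  using integral_distr[OF measurable_translation_lebesgue[of a] assms]
  by (simp add: distr_translation_lebesgue)

lemma integrable_translation_lebesgue:
  fixes f :: "'a::euclidean_space \<Rightarrow> real"
  assumes "integrable lebesgue f"
  shows "integrable lebesgue (\<lambda>t. f (a + t))"
  using integrable_distr[OF measurable_translation_lebesgue[of a]] assms
  by (simp add: distr_translation_lebesgue)

text \<open>The discontinuities lie in a null Borel set \<open>N\<close>. Off \<open>N\<close> the
  function is continuous, so cutting it off to 0 on \<open>N\<close> gives a Borel function that
  agrees with \<open>g\<close> almost everywhere.\<close>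

lemma AE_isCont_imp_measurable:
  fixes g :: "'a::euclidean_space \<Rightarrow> real"
  assumes "AE t in lebesgue. isCont g t"
  shows "g \<in> borel_measurable lebesgue"
proof -
  have "AE t in lborel. isCont g t"
    using assms by (simp add: AE_completion_iff)
  then obtain N where N: "{t. \<not> isCont g t} \<subseteq> N" "N \<in> null_sets lborel"
    by (auto elim!: AE_E simp: null_sets_def)
  have "continuous_on (- N) g"
    using N(1) by (auto intro: continuous_at_imp_continuous_on)
  then have "(\<lambda>t. indicator (- N) t *\<^sub>R g t) \<in> borel_measurable borel"
    using N(2) by (intro borel_measurable_continuous_on_indicator) auto
  then have "(\<lambda>t. indicator (- N) t *\<^sub>R g t) \<in> borel_measurable lebesgue"
    by (simp add: measurable_completion)
  moreover have "AE t in lebesgue. indicator (- N) t *\<^sub>R g t = g t"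
    using AE_not_in[OF null_sets_completionI[OF N(2)]] by eventually_elim simp
  ultimately show ?thesis
    by (rule borel_measurable_AE)
qed

section \<open>Differentiation under the integral sign\<close>

lemma DERIV_LIMSEQ_difference_quotient:
  fixes f :: "real \<Rightarrow> real"
  assumes "(f has_real_derivative D) (at 0)" "X \<longlonglongrightarrow> 0" "\<And>i::nat. X i \<noteq> 0"
  shows "(\<lambda>i. (f (X i) - f 0) / X i) \<longlonglongrightarrow> D"
  using assms unfolding DERIV_def tendsto_at_iff_sequentially by (auto simp: o_def)

text \<open>The derivative is the limit of difference quotients along 1 / (i + 1). The measurability
  of the intermediate partial derivatives of \<open>f\<close>, whose continuity is not assumed,
  comes from here.\<close>

lemma measurable_DERIV:
  fixes F :: "real \<Rightarrow> 'a \<Rightarrow> real"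
  assumes "\<And>h. F h \<in> borel_measurable M"
    and "\<And>x. ((\<lambda>h. F h x) has_real_derivative F' x) (at 0)"
  shows "F' \<in> borel_measurable M"
proof (rule borel_measurable_LIMSEQ_metric)
  fix x
  show "(\<lambda>i. (F (inverse (Suc i)) x - F 0 x) / inverse (Suc i)) \<longlonglongrightarrow> F' x"
    by (rule DERIV_LIMSEQ_difference_quotient[OF assms(2) LIMSEQ_inverse_real_of_nat]) simp
qed (use assms(1) in measurable)

text \<open>The mean value inequality turns the bound \<open>w\<close> on the derivative into a
  majorant of all difference quotients, so dominated convergence applies along every null sequence.
  Bounds are available only for |h| < 1, hence the passage to a tail of the sequence.\<close>

lemma integral_DERIV_dominated:
  fixes F F' :: "real \<Rightarrow> 'a \<Rightarrow> real"
  assumes int: "\<And>h. \<bar>h\<bar> < 1 \<Longrightarrow> integrable M (F h)"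
    and D: "\<And>h x. \<bar>h\<bar> < 1 \<Longrightarrow> ((\<lambda>h. F h x) has_real_derivative F' h x) (at h)"
    and bd: "\<And>h x. \<bar>h\<bar> < 1 \<Longrightarrow> \<bar>F' h x\<bar> \<le> w x"
    and w: "integrable M w"
    and meas: "F' 0 \<in> borel_measurable M"
  shows "((\<lambda>h. LINT x|M. F h x) has_real_derivative (LINT x|M. F' 0 x)) (at 0)"
  unfolding DERIV_def tendsto_at_iff_sequentially o_def
proof (intro allI impI)
  fix X :: "nat \<Rightarrow> real"
  assume X: "\<forall>i. X i \<in> UNIV - {0}" and lim: "X \<longlonglongrightarrow> 0"
  have "eventually (\<lambda>i. \<bar>X i\<bar> < 1) sequentially"
    using order_tendstoD(2)[OF tendsto_rabs_zero[OF lim], of 1] by simp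
  then obtain N where N: "\<And>i. i \<ge> N \<Longrightarrow> \<bar>X i\<bar> < 1"
    by (auto simp: eventually_sequentially)
  define Y where "Y i = X (i + N)" for i
  have Y: "\<bar>Y i\<bar> < 1" "Y i \<noteq> 0" for i
    using N X by (auto simp: Y_def)
  have "Y \<longlonglongrightarrow> 0"
    unfolding Y_def using lim by (rule LIMSEQ_ignore_initial_segment)
  have "(\<lambda>i. LINT x|M. (F (Y i) x - F 0 x) / Y i) \<longlonglongrightarrow> (LINT x|M. F' 0 x)"
  proof (rule integral_dominated_convergence[OF meas _ w])
    show "(\<lambda>x. (F (Y i) x - F 0 x) / Y i) \<in> borel_measurable M" for i
      using int[OF Y(1), of i] int[of 0] by auto
    show "AE x in M. (\<lambda>i. (F (Y i) x - F 0 x) / Y i) \<longlonglongrightarrow> F' 0 x"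
      using DERIV_LIMSEQ_difference_quotient[OF D[of 0] \<open>Y \<longlonglongrightarrow> 0\<close> Y(2)] by simp
    have "\<bar>F (Y i) x - F 0 x\<bar> \<le> w x * \<bar>Y i\<bar>" for i x
      using field_differentiable_bound[of "{-1<..<1}" "\<lambda>h. F h x" "\<lambda>h. F' h x" "w x" "Y i" 0] D bd Y(1)[of i]
      by (auto intro: has_field_derivative_at_within simp: abs_less_iff)
    then show "AE x in M. norm ((F (Y i) x - F 0 x) / Y i) \<le> w x" for i
      using Y(2)[of i] by (simp add: pos_divide_le_eq)
  qed
  then have "(\<lambda>i. ((LINT x|M. F (X (i + N)) x) - (LINT x|M. F 0 x)) / X (i + N)) \<longlonglongrightarrow> (LINT x|M. F' 0 x)"
    using int[OF Y(1)] int[of 0] by (simp add: Bochner_Integration.integral_diff Y_def)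
  then show "(\<lambda>i. ((LINT x|M. F (0 + X i) x) - (LINT x|M. F 0 x)) / X i) \<longlonglongrightarrow> (LINT x|M. F' 0 x)"
    using LIMSEQ_offset[where k = N and f = "\<lambda>i. ((LINT x|M. F (X i) x) - (LINT x|M. F 0 x)) / X i"] by simp
qed

text \<open>The sum norm is chosen because its exponential splits over the coordinates. Evaluation
  at t = 0 shows that \<open>C\<close> is nonnegative.\<close>

definition exp_decay :: "(real ^ 'n::finite \<Rightarrow> real) \<Rightarrow> bool" where
  "exp_decay F \<longleftrightarrow> (\<exists>C \<epsilon>. 0 < \<epsilon> \<and> (\<forall>t. \<bar>F t\<bar> \<le> C * exp (- \<epsilon> * (\<Sum>i\<in>UNIV. \<bar>t $ i\<bar>))))"

lemma exp_decay_integrable: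
  assumes "exp_decay F" "F \<in> borel_measurable lebesgue"
  shows "integrable lebesgue F"
proof -
  obtain C \<epsilon> where "0 < \<epsilon>" "\<And>t. \<bar>F t\<bar> \<le> C * exp (- \<epsilon> * (\<Sum>i\<in>UNIV. \<bar>t $ i\<bar>))"
    using assms(1) unfolding exp_decay_def by blast
  then show ?thesis
    using assms(2)
    by (intro Bochner_Integration.integrable_bound[OF integrable_mult_right[OF integrable_exp_minus_sum_abs]])
       (auto intro: order_trans[OF _ abs_ge_self])
qed

lemma exp_decay_mult:
  assumes "exp_decay F"
  shows "exp_decay (\<lambda>t. c * F t)"
proof -
  obtain C \<epsilon> where "0 < \<epsilon>" "\<And>t. \<bar>F t\<bar> \<le> C * exp (- \<epsilon> * (\<Sum>i\<in>UNIV. \<bar>t $ i\<bar>))"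
    using assms unfolding exp_decay_def by blast
  then show ?thesis
    unfolding exp_decay_def abs_mult
    by (intro exI[of _ "\<bar>c\<bar> * C"] exI[of _ \<epsilon>]) (auto simp: mult.assoc intro!: mult_left_mono)
qed

lemma exp_decay_add:
  assumes "exp_decay F" "exp_decay G"
  shows "exp_decay (\<lambda>t. F t + G t)"
proof -
  let ?S = "\<lambda>t :: real ^ 'a. \<Sum>i\<in>UNIV. \<bar>t $ i\<bar>"
  obtain C \<epsilon> D \<delta> where \<epsilon>: "0 < \<epsilon>" and F: "\<And>t. \<bar>F t\<bar> \<le> C * exp (- \<epsilon> * ?S t)"
    and \<delta>: "0 < \<delta>" and G: "\<And>t. \<bar>G t\<bar> \<le> D * exp (- \<delta> * ?S t)"
    using assms unfolding exp_decay_def by blast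
  have nonneg: "0 \<le> C" "0 \<le> D"
    using order_trans[OF abs_ge_zero F[of 0]] order_trans[OF abs_ge_zero G[of 0]] by simp_all
  have "\<bar>F t + G t\<bar> \<le> (C + D) * exp (- min \<epsilon> \<delta> * ?S t)" for t
  proof -
    have "0 \<le> ?S t" by (simp add: sum_nonneg)
    then have "min \<epsilon> \<delta> * ?S t \<le> \<epsilon> * ?S t" "min \<epsilon> \<delta> * ?S t \<le> \<delta> * ?S t"
      by (auto intro: mult_right_mono)
    then have "C * exp (- \<epsilon> * ?S t) \<le> C * exp (- min \<epsilon> \<delta> * ?S t)"
      "D * exp (- \<delta> * ?S t) \<le> D * exp (- min \<epsilon> \<delta> * ?S t)"
      using nonneg by (auto intro!: mult_left_mono)
    then show ?thesis
      using F[of t] G[of t] by (simp add: distrib_right)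
  qed
  then show ?thesis
    unfolding exp_decay_def using \<epsilon> \<delta> by (intro exI[of _ "C + D"] exI[of _ "min \<epsilon> \<delta>"]) simp
qed

lemma sum_abs_shift_ge:
  fixes t d :: "real ^ 'n::finite"
  assumes "\<bar>h\<bar> < 1"
  shows "(\<Sum>i\<in>UNIV. \<bar>t $ i\<bar>) - (\<Sum>i\<in>UNIV. \<bar>d $ i\<bar>) \<le> (\<Sum>i\<in>UNIV. \<bar>(t + h *\<^sub>R d) $ i\<bar>)"
proof -
  have "(\<Sum>i\<in>UNIV. \<bar>t $ i\<bar>) \<le> (\<Sum>i\<in>UNIV. \<bar>(t + h *\<^sub>R d) $ i\<bar> + \<bar>d $ i\<bar>)"
  proof (rule sum_mono)
    fix i
    have "\<bar>h * d $ i\<bar> \<le> 1 * \<bar>d $ i\<bar>"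
      unfolding abs_mult using assms by (intro mult_right_mono) auto
    then show "\<bar>t $ i\<bar> \<le> \<bar>(t + h *\<^sub>R d) $ i\<bar> + \<bar>d $ i\<bar>"
      by simp
  qed
  then show ?thesis
    by (simp add: sum.distrib)
qed

text \<open>The integrals of all translates \<open>H (t + h d)\<close> agree, so the integral of the derivative in
  \<open>h\<close> vanishes.\<close>

lemma integral_directional_derivative_eq_0:
  fixes H H' :: "real ^ 'n::finite \<Rightarrow> real"
  assumes H: "integrable lebesgue H" and H': "exp_decay H'"
    and D: "\<And>t. ((\<lambda>h. H (t + h *\<^sub>R d)) has_real_derivative H' t) (at 0)"
  shows "(LINT t|lebesgue. H' t) = 0"
proof -
  obtain C \<epsilon> where \<epsilon>: "0 < \<epsilon>" and bd: "\<And>t. \<bar>H' t\<bar> \<le> C * exp (- \<epsilon> * (\<Sum>i\<in>UNIV. \<bar>t $ i\<bar>))"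
    using H' unfolding exp_decay_def by blast
  have int: "integrable lebesgue (\<lambda>t. H (t + h *\<^sub>R d))" for h
    using integrable_translation_lebesgue[OF H, of "h *\<^sub>R d"] by (simp add: add.commute)
  \<comment> \<open>The hypothesis at the base point t + h d gives the derivative at every h, not
    only at 0.\<close>
  have D': "((\<lambda>h. H (t + h *\<^sub>R d)) has_real_derivative H' (t + h *\<^sub>R d)) (at h)" for t h
    using D[of "t + h *\<^sub>R d"] DERIV_shift[of "\<lambda>h. H (t + h *\<^sub>R d)" _ 0 h]
    by (simp add: algebra_simps)
  have C: "0 \<le> C"
    using order_trans[OF abs_ge_zero bd[of 0]] by simp
  let ?S = "\<lambda>t :: real ^ 'n. \<Sum>i\<in>UNIV. \<bar>t $ i\<bar>"
  \<comment> \<open>A shift by less than one step of \<open>d\<close> costs only the constant factor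
    exp(\<epsilon> |d|), with |d| the sum norm, so one integrable majorant serves all |h| <
    1.\<close>
  have bd': "\<bar>H' (t + h *\<^sub>R d)\<bar> \<le> C * exp (\<epsilon> * ?S d) * exp (- \<epsilon> * ?S t)" if "\<bar>h\<bar> < 1" for t h
  proof -
    have "- \<epsilon> * ?S (t + h *\<^sub>R d) \<le> \<epsilon> * ?S d + - \<epsilon> * ?S t"
      using mult_left_mono[OF sum_abs_shift_ge[OF that, of t d], of \<epsilon>] \<epsilon> by (simp add: algebra_simps)
    then have "C * exp (- \<epsilon> * ?S (t + h *\<^sub>R d)) \<le> C * exp (\<epsilon> * ?S d + - \<epsilon> * ?S t)"
      using C by (intro mult_left_mono) auto
    then show ?thesis
      unfolding exp_add mult.assoc[symmetric] by (rule order_trans[OF bd])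
  qed
  have "((\<lambda>h. LINT t|lebesgue. H (t + h *\<^sub>R d)) has_real_derivative
      (LINT t|lebesgue. H' (t + 0 *\<^sub>R d))) (at 0)"
  proof (rule integral_DERIV_dominated[OF int D' bd'])
    show "integrable lebesgue (\<lambda>t. C * exp (\<epsilon> * ?S d) * exp (- \<epsilon> * ?S t))"
      by (intro integrable_mult_right integrable_exp_minus_sum_abs \<epsilon>)
    show "(\<lambda>t. H' (t + 0 *\<^sub>R d)) \<in> borel_measurable lebesgue"
      using int by (intro measurable_DERIV[OF _ D'] borel_measurable_integrable)
  qed
  moreover have "(LINT t|lebesgue. H (t + h *\<^sub>R d)) = (LINT t|lebesgue. H t)" for h
    using integral_translation_lebesgue[OF borel_measurable_integrable[OF H], of "h *\<^sub>R d"]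
    by (simp add: add.commute)
  ultimately show ?thesis
    using DERIV_unique[OF _ DERIV_const] by simp
qed

section \<open>Kernels depending on dual phases\<close>

text \<open>\<open>p\<^sub>k S\<^sub>e\<^sub>k\<close> acts together with the rate \<open>\<sigma> k p\<^sub>0\<close> at which the real part of the kernel grows
  along the direction \<open>d k\<close>.\<close>

definition D_op :: "(nat \<Rightarrow> real) \<Rightarrow> cd \<Rightarrow> nat \<Rightarrow> (cd \<Rightarrow> cd) \<Rightarrow> cd \<Rightarrow> cd" where
  "D_op \<sigma> p k G = (\<lambda>\<zeta> i. \<sigma> k * p 0 * G \<zeta> i + pS_op p k G \<zeta> i)"

definition dir_shift :: "(nat \<Rightarrow> real ^ 'n) \<Rightarrow> nat \<Rightarrow> real ^ 'n::finite \<Rightarrow> real \<Rightarrow> real ^ 'n" where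
  "dir_shift d k t h = t + h *\<^sub>R d k"

text \<open>The closed form of the kernel is demanded only for \<zeta> in \<open>cd_params\<close>,
  where the components above n vanish. Later equalities between functions of \<zeta> are therefore
  restricted to this set; it is preserved by shifts of \<zeta>_k with k in
  \<open>{1..n}\<close>.\<close>

locale phase_kernel =
  fixes r n :: nat and p :: cd and u :: "cd \<Rightarrow> real ^ 'n::finite \<Rightarrow> cd \<Rightarrow> cd"
    and d :: "nat \<Rightarrow> real ^ 'n" and \<tau> :: "nat \<Rightarrow> real ^ 'n \<Rightarrow> real" and \<sigma> :: "nat \<Rightarrow> real"
    and \<Psi> :: "nat \<Rightarrow> cd \<Rightarrow> real"
  assumes n_less: "n < 2 ^ r"
    and linear_\<tau>: "linear (\<tau> k)"
    and \<tau>_dual: "\<lbrakk>k \<in> {1..n}; l \<in> {1..n}\<rbrakk> \<Longrightarrow> \<tau> k (d l) = (if k = l then 1 else 0)"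
    and \<tau>_le: "\<bar>\<tau> k t\<bar> \<le> (\<Sum>i\<in>UNIV. \<bar>t $ i\<bar>)"
    and sum_d: "k \<in> {1..n} \<Longrightarrow> (\<Sum>i\<in>UNIV. d k $ i) = \<sigma> k"
    and tempered_\<Psi>: "b < 2 ^ r \<Longrightarrow> tempered n (\<Psi> b)"
    and cd_exp_kernel: "\<lbrakk>\<zeta> \<in> cd_params r n; b < 2 ^ r\<rbrakk> \<Longrightarrow>
      cd_exp r (\<lambda>k. - u p t \<zeta> k) b =
        exp (- (p 0 * (\<Sum>i\<in>UNIV. t $ i) + \<zeta> 0)) *
        \<Psi> b (\<lambda>k. if k \<in> {1..n} then p k * \<tau> k t + \<zeta> k else 0)"
begin

definition phase :: "real ^ 'n \<Rightarrow> cd \<Rightarrow> cd" where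
  "phase t \<zeta> = (\<lambda>k. if k \<in> {1..n} then p k * \<tau> k t + \<zeta> k else 0)"

definition weight :: "cd \<Rightarrow> real ^ 'n \<Rightarrow> real" where
  "weight \<zeta> t = exp (- (p 0 * (\<Sum>i\<in>UNIV. t $ i) + \<zeta> 0))"

text \<open>This is the form in which the position of p_0 strictly between the growth exponents
  enters. The factor exp(- \<zeta>_0) of \<open>weight\<close> is constant in t and left
  out.\<close>

definition dominated :: "(real ^ 'n \<Rightarrow> real) \<Rightarrow> bool" where
  "dominated G \<longleftrightarrow> exp_decay (\<lambda>t. G t * exp (- (p 0 * (\<Sum>i\<in>UNIV. t $ i))))"

definition component :: "(real ^ 'n \<Rightarrow> real) \<Rightarrow> (cd \<Rightarrow> real) \<Rightarrow> cd \<Rightarrow> real" where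
  "component G \<Phi> \<zeta> = (LINT t|lebesgue. G t * (weight \<zeta> t * \<Phi> (phase t \<zeta>)))"

section \<open>Scalar integrals against weights and functions of the phases\<close>

lemma phase_cd_shift:
  assumes "k \<in> {1..n}"
  shows "phase t (cd_shift k \<zeta> h) = (phase t \<zeta>)(k := phase t \<zeta> k + h)"
  using assms by (auto simp: phase_def cd_shift_def)

lemma weight_cd_shift: "k \<in> {1..n} \<Longrightarrow> weight (cd_shift k \<zeta> h) = weight \<zeta>"
  by (auto simp: weight_def cd_shift_def)

lemma phase_dir_shift:
  assumes "k \<in> {1..n}"
  shows "phase (t + h *\<^sub>R d k) \<zeta> = (phase t \<zeta>)(k := phase t \<zeta> k + p k * h)"
  using assms \<tau>_dual by (auto simp: phase_def linear_add[OF linear_\<tau>] linear_scale[OF linear_\<tau>] algebra_simps)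

lemma weight_dir_shift:
  assumes "k \<in> {1..n}"
  shows "weight \<zeta> (t + h *\<^sub>R d k) = weight \<zeta> t * exp (- (p 0 * \<sigma> k * h))"
  using sum_d[OF assms]
  by (simp add: weight_def sum.distrib algebra_simps flip: sum_distrib_left exp_add)

lemma borel_measurable_phase: "(\<lambda>t. phase t \<zeta> k) \<in> borel_measurable lebesgue"
proof -
  have "\<tau> k \<in> borel_measurable borel"
    by (intro borel_measurable_continuous_onI linear_continuous_on linear_conv_bounded_linear[THEN iffD1] linear_\<tau>)
  then have "(\<lambda>t. phase t \<zeta> k) \<in> borel_measurable borel"
    unfolding phase_def by measurable
  then show ?thesis
    by (simp add: measurable_completion)
qed

lemma borel_measurable_integrand:
  assumes "G \<in> borel_measurable lebesgue" "tempered n \<Phi>"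
  shows "(\<lambda>t. G t * (weight \<zeta> t * \<Phi> (phase t \<zeta>))) \<in> borel_measurable lebesgue"
proof -
  have "weight \<zeta> \<in> borel_measurable borel"
    unfolding weight_def by measurable
  then have "weight \<zeta> \<in> borel_measurable lebesgue"
    by (simp add: measurable_completion)
  then show ?thesis
    using assms(1) tempered_measurable[OF assms(2) borel_measurable_phase] by measurable
qed

lemma sum_abs_phase_le:
  "(\<Sum>k = 1..n. \<bar>phase t \<zeta> k\<bar>) \<le>
    (\<Sum>k = 1..n. \<bar>p k\<bar>) * (\<Sum>i\<in>UNIV. \<bar>t $ i\<bar>) + (\<Sum>k = 1..n. \<bar>\<zeta> k\<bar>)"
proof -
  have "\<bar>phase t \<zeta> k\<bar> \<le> \<bar>p k\<bar> * (\<Sum>i\<in>UNIV. \<bar>t $ i\<bar>) + \<bar>\<zeta> k\<bar>" if "k \<in> {1..n}" for k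
  proof -
    have "\<bar>phase t \<zeta> k\<bar> \<le> \<bar>p k\<bar> * \<bar>\<tau> k t\<bar> + \<bar>\<zeta> k\<bar>"
      using that by (simp add: phase_def flip: abs_mult)
    also have "\<dots> \<le> \<bar>p k\<bar> * (\<Sum>i\<in>UNIV. \<bar>t $ i\<bar>) + \<bar>\<zeta> k\<bar>"
      by (intro add_right_mono mult_left_mono \<tau>_le) simp
    finally show ?thesis .
  qed
  then have "(\<Sum>k = 1..n. \<bar>phase t \<zeta> k\<bar>) \<le> (\<Sum>k = 1..n. \<bar>p k\<bar> * (\<Sum>i\<in>UNIV. \<bar>t $ i\<bar>) + \<bar>\<zeta> k\<bar>)"
    by (rule sum_mono)
  then show ?thesis
    by (simp only: sum.distrib sum_distrib_right)
qed

text \<open>One bound holds for all \<zeta> with fixed \<zeta>_0 and bounded remaining components,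
  because differentiation in \<zeta>_k under the integral needs a majorant independent of the
  shift.\<close>

lemma integrand_bound:
  assumes "dominated G" "tempered n \<Phi>"
  shows "\<exists>C \<epsilon>. 0 < \<epsilon> \<and> (\<forall>t \<zeta>. (\<Sum>k = 1..n. \<bar>\<zeta> k\<bar>) \<le> Z \<longrightarrow> \<zeta> 0 = z \<longrightarrow>
      \<bar>G t * (weight \<zeta> t * \<Phi> (phase t \<zeta>))\<bar> \<le> C * exp (- \<epsilon> * (\<Sum>i\<in>UNIV. \<bar>t $ i\<bar>)))"
proof -
  let ?S = "\<lambda>t :: real ^ 'n. \<Sum>i\<in>UNIV. \<bar>t $ i\<bar>"
  let ?w = "\<lambda>t :: real ^ 'n. exp (- (p 0 * (\<Sum>i\<in>UNIV. t $ i)))"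
  obtain C \<epsilon> where \<epsilon>: "0 < \<epsilon>" and C: "\<And>t. \<bar>G t * ?w t\<bar> \<le> C * exp (- \<epsilon> * ?S t)"
    using assms(1) unfolding dominated_def exp_decay_def by blast
  have C0: "0 \<le> C" using order_trans[OF abs_ge_zero C[of 0]] by simp
  define P where "P = (\<Sum>k = 1..n. \<bar>p k\<bar>)"
  have P: "0 \<le> P" unfolding P_def by (simp add: sum_nonneg)
  \<comment> \<open>The phases grow at most like \<open>P\<close> times the sum norm of t, up to a
    constant. This \<delta> lets \<Phi> consume at most half of the decay rate \<epsilon>; the
    summand 1 keeps the denominator positive when all p_k vanish.\<close>
  define \<delta> where "\<delta> = \<epsilon> / (2 * (P + 1))"
  have \<delta>: "0 < \<delta>" "\<delta> * P \<le> \<epsilon> / 2"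
    using P \<epsilon> by (auto simp: \<delta>_def field_simps)
  obtain D where D0: "0 \<le> D" and D: "\<And>\<psi>. \<bar>\<Phi> \<psi>\<bar> \<le> D * exp (\<delta> * (\<Sum>k = 1..n. \<bar>\<psi> k\<bar>))"
    using tempered_subexp[OF assms(2) \<delta>(1)] by blast
  show ?thesis
  proof (rule exI[of _ "exp (- z) * C * D * exp (\<delta> * Z)"], rule exI[of _ "\<epsilon> / 2"], intro conjI allI impI)
    fix t and \<zeta> :: cd
    assume Z: "(\<Sum>k = 1..n. \<bar>\<zeta> k\<bar>) \<le> Z" and z: "\<zeta> 0 = z"
    have "0 \<le> ?S t" by (simp add: sum_nonneg)
    have "\<delta> * (\<Sum>k = 1..n. \<bar>phase t \<zeta> k\<bar>) \<le> \<delta> * (P * ?S t + Z)"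
      using sum_abs_phase_le[of t \<zeta>] Z \<delta>(1) unfolding P_def by (intro mult_left_mono) auto
    also have "\<dots> \<le> \<epsilon> / 2 * ?S t + \<delta> * Z"
      using mult_right_mono[OF \<delta>(2) \<open>0 \<le> ?S t\<close>] by (simp add: algebra_simps)
    finally have "D * exp (\<delta> * (\<Sum>k = 1..n. \<bar>phase t \<zeta> k\<bar>)) \<le> D * exp (\<epsilon> / 2 * ?S t + \<delta> * Z)"
      using D0 by (intro mult_left_mono) auto
    then have \<Phi>: "\<bar>\<Phi> (phase t \<zeta>)\<bar> \<le> D * exp (\<epsilon> / 2 * ?S t + \<delta> * Z)"
      using D[of "phase t \<zeta>"] by linarith
    have "\<bar>G t * (weight \<zeta> t * \<Phi> (phase t \<zeta>))\<bar> = exp (- z) * (\<bar>G t * ?w t\<bar> * \<bar>\<Phi> (phase t \<zeta>)\<bar>)"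
    proof -
      have "weight \<zeta> t = exp (- z) * ?w t"
        by (simp add: weight_def z flip: exp_add)
      then show ?thesis by (simp add: abs_mult mult_ac)
    qed
    also have "\<dots> \<le> exp (- z) * ((C * exp (- \<epsilon> * ?S t)) * (D * exp (\<epsilon> / 2 * ?S t + \<delta> * Z)))"
      using C0 by (intro mult_left_mono mult_mono C \<Phi>) auto
    also have "\<dots> = exp (- z) * C * D * exp (\<delta> * Z) * exp (- (\<epsilon> / 2) * ?S t)"
    proof -
      have "exp (- \<epsilon> * ?S t) * exp (\<epsilon> / 2 * ?S t + \<delta> * Z) = exp (\<delta> * Z) * exp (- (\<epsilon> / 2) * ?S t)"
        unfolding exp_add[symmetric] by (simp add: field_simps)
      then show ?thesis by simp
    qed
    finally show "\<bar>G t * (weight \<zeta> t * \<Phi> (phase t \<zeta>))\<bar> \<le>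
        exp (- z) * C * D * exp (\<delta> * Z) * exp (- (\<epsilon> / 2) * ?S t)" .
  qed (use \<epsilon> in simp)
qed

lemma exp_decay_integrand:
  assumes "dominated G" "tempered n \<Phi>"
  shows "exp_decay (\<lambda>t. G t * (weight \<zeta> t * \<Phi> (phase t \<zeta>)))"
  unfolding exp_decay_def
  using integrand_bound[OF assms, of "\<Sum>k = 1..n. \<bar>\<zeta> k\<bar>" "\<zeta> 0"]
  by (elim ex_forward conj_forward) simp_all

lemma integrable_integrand:
  assumes "G \<in> borel_measurable lebesgue" "dominated G" "tempered n \<Phi>"
  shows "integrable lebesgue (\<lambda>t. G t * (weight \<zeta> t * \<Phi> (phase t \<zeta>)))"
  by (intro exp_decay_integrable exp_decay_integrand borel_measurable_integrand assms)

lemma DERIV_component: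
  assumes G: "G \<in> borel_measurable lebesgue" "dominated G"
    and k: "k \<in> {1..n}" and \<Phi>: "tempered n \<Phi>" "tempered n \<Phi>'" "partial_of k \<Phi> \<Phi>'"
  shows "((\<lambda>h. component G \<Phi> (cd_shift k \<zeta> h)) has_real_derivative component G \<Phi>' \<zeta>) (at 0)"
proof -
  \<comment> \<open>The radius is enlarged by 1 in order to cover the shifts of \<zeta>_k by |h| <
    1.\<close>
  obtain C \<epsilon> where \<epsilon>: "0 < \<epsilon>" and
    C: "\<forall>t \<zeta>'. (\<Sum>k = 1..n. \<bar>\<zeta>' k\<bar>) \<le> (\<Sum>k = 1..n. \<bar>\<zeta> k\<bar>) + 1 \<longrightarrow> \<zeta>' 0 = \<zeta> 0 \<longrightarrow>
      \<bar>G t * (weight \<zeta>' t * \<Phi>' (phase t \<zeta>'))\<bar> \<le> C * exp (- \<epsilon> * (\<Sum>i\<in>UNIV. \<bar>t $ i\<bar>))"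
    using integrand_bound[OF G(2) \<Phi>(2), of "(\<Sum>k = 1..n. \<bar>\<zeta> k\<bar>) + 1" "\<zeta> 0"] by blast
  have "((\<lambda>h. LINT t|lebesgue. G t * (weight (cd_shift k \<zeta> h) t * \<Phi> (phase t (cd_shift k \<zeta> h))))
      has_real_derivative
        (LINT t|lebesgue. G t * (weight (cd_shift k \<zeta> 0) t * \<Phi>' (phase t (cd_shift k \<zeta> 0))))) (at 0)"
  proof (rule integral_DERIV_dominated)
    show "integrable lebesgue (\<lambda>t. G t * (weight (cd_shift k \<zeta> h) t * \<Phi> (phase t (cd_shift k \<zeta> h))))" for h
      by (intro integrable_integrand G \<Phi>)
    show "(\<lambda>t. G t * (weight (cd_shift k \<zeta> 0) t * \<Phi>' (phase t (cd_shift k \<zeta> 0)))) \<in> borel_measurable lebesgue"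
      by (intro borel_measurable_integrand G \<Phi>)
    show "integrable lebesgue (\<lambda>t::real ^ 'n. C * exp (- \<epsilon> * (\<Sum>i\<in>UNIV. \<bar>t $ i\<bar>)))"
      by (intro integrable_mult_right integrable_exp_minus_sum_abs \<epsilon>)
    show "\<bar>G t * (weight (cd_shift k \<zeta> h) t * \<Phi>' (phase t (cd_shift k \<zeta> h)))\<bar>
        \<le> C * exp (- \<epsilon> * (\<Sum>i\<in>UNIV. \<bar>t $ i\<bar>))" if "\<bar>h\<bar> < 1" for h t
    proof (rule C[rule_format])
      have "(\<Sum>l = 1..n. \<bar>cd_shift k \<zeta> h l\<bar>) \<le> (\<Sum>l = 1..n. \<bar>\<zeta> l\<bar> + (if l = k then \<bar>h\<bar> else 0))"
        by (intro sum_mono) (auto simp: cd_shift_def)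
      then show "(\<Sum>l = 1..n. \<bar>cd_shift k \<zeta> h l\<bar>) \<le> (\<Sum>l = 1..n. \<bar>\<zeta> l\<bar>) + 1"
        using that k by (simp add: sum.distrib)
      show "cd_shift k \<zeta> h 0 = \<zeta> 0"
        using k by (auto simp: cd_shift_def)
    qed
    show "((\<lambda>h. G t * (weight (cd_shift k \<zeta> h) t * \<Phi> (phase t (cd_shift k \<zeta> h)))) has_real_derivative
        G t * (weight (cd_shift k \<zeta> h) t * \<Phi>' (phase t (cd_shift k \<zeta> h)))) (at h)" for h t
    proof -
      have "((\<lambda>h. \<Phi> ((phase t \<zeta>)(k := phase t \<zeta> k + h))) has_real_derivative
          \<Phi>' ((phase t \<zeta>)(k := phase t \<zeta> k + h))) (at h)"
        using \<Phi>(3)[unfolded partial_of_def, rule_format, of "phase t \<zeta>" "h + phase t \<zeta> k"]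
        by (subst (asm) DERIV_shift) (simp add: add.commute)
      then show ?thesis
        unfolding phase_cd_shift[OF k] weight_cd_shift[OF k] by (intro DERIV_cmult)
    qed
  qed
  moreover have "cd_shift k \<zeta> 0 = \<zeta>" by (simp add: cd_shift_def)
  ultimately show ?thesis
    unfolding component_def by simp
qed

text \<open>Integration by parts: the product rule along \<open>d k\<close> yields three integrable
  terms of total integral 0. By duality only the phase of index k moves, at rate p_k, and the weight
  contributes the factor - \<sigma>_k p_0.\<close>

lemma component_directional_derivative:
  assumes G: "G \<in> borel_measurable lebesgue" "dominated G" "dominated G'"
    and D: "\<And>t. ((\<lambda>h. G (t + h *\<^sub>R d k)) has_real_derivative G' t) (at 0)"
    and k: "k \<in> {1..n}" and \<Phi>: "tempered n \<Phi>" "tempered n \<Phi>'" "partial_of k \<Phi> \<Phi>'"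
  shows "component G' \<Phi> \<zeta> = \<sigma> k * p 0 * component G \<Phi> \<zeta> - p k * component G \<Phi>' \<zeta>"
proof -
  have G': "G' \<in> borel_measurable lebesgue"
  proof (rule measurable_DERIV[OF _ D])
    show "(\<lambda>t. G (t + h *\<^sub>R d k)) \<in> borel_measurable lebesgue" for h
      using measurable_compose[OF measurable_translation_lebesgue[of "h *\<^sub>R d k"] G(1)]
      by (simp add: add.commute)
  qed
  let ?A = "\<lambda>t. G' t * (weight \<zeta> t * \<Phi> (phase t \<zeta>))"
  let ?B = "\<lambda>t. (- (\<sigma> k * p 0)) * (G t * (weight \<zeta> t * \<Phi> (phase t \<zeta>)))"
  let ?C = "\<lambda>t. p k * (G t * (weight \<zeta> t * \<Phi>' (phase t \<zeta>)))"
  have int: "integrable lebesgue ?A" "integrable lebesgue ?B" "integrable lebesgue ?C"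
    by (intro integrable_mult_right integrable_integrand G G' \<Phi>)+
  have "(LINT t|lebesgue. ?A t + ?B t + ?C t) = 0"
  proof (rule integral_directional_derivative_eq_0)
    show "integrable lebesgue (\<lambda>t. G t * (weight \<zeta> t * \<Phi> (phase t \<zeta>)))"
      by (intro integrable_integrand G \<Phi>)
    show "exp_decay (\<lambda>t. ?A t + ?B t + ?C t)"
      by (intro exp_decay_add exp_decay_mult exp_decay_integrand G \<Phi>)
    fix t
    have "((\<lambda>h. \<Phi> ((phase t \<zeta>)(k := phase t \<zeta> k + p k * h))) has_real_derivative
        \<Phi>' ((phase t \<zeta>)(k := phase t \<zeta> k + p k * 0)) * p k) (at 0)"
      by (rule DERIV_chain2[OF \<Phi>(3)[unfolded partial_of_def, rule_format]])
         (auto intro!: derivative_eq_intros)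
    then show "((\<lambda>h. G (t + h *\<^sub>R d k) * (weight \<zeta> (t + h *\<^sub>R d k) * \<Phi> (phase (t + h *\<^sub>R d k) \<zeta>)))
        has_real_derivative ?A t + ?B t + ?C t) (at 0)"
      unfolding phase_dir_shift[OF k] weight_dir_shift[OF k]
      by (auto intro!: derivative_eq_intros D simp: algebra_simps)
  qed
  then have "component G' \<Phi> \<zeta> + - (\<sigma> k * p 0) * component G \<Phi> \<zeta> + p k * component G \<Phi>' \<zeta> = 0"
    using int unfolding component_def by (simp add: Bochner_Integration.integral_add)
  then show ?thesis by simp
qed

definition admissible :: "(real ^ 'n \<Rightarrow> cd) \<Rightarrow> bool" where
  "admissible g \<longleftrightarrow> (\<forall>a<2 ^ r. (\<lambda>t. g t a) \<in> borel_measurable lebesgue \<and> dominated (\<lambda>t. g t a))"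

text \<open>The product in the algebra is written through structure constants, with each product of
  coordinates replaced by its integral. Derivatives in \<zeta> then act on the family \<Phi>
  alone.\<close>

definition expansion :: "(real ^ 'n \<Rightarrow> cd) \<Rightarrow> (nat \<Rightarrow> cd \<Rightarrow> real) \<Rightarrow> cd \<Rightarrow> cd" where
  "expansion g \<Phi> \<zeta> i =
    (\<Sum>a<2 ^ r. \<Sum>b<2 ^ r. cd_mult r (cd_unit a) (cd_unit b) i * component (\<lambda>t. g t a) (\<Phi> b) \<zeta>)"

text \<open>An invariant preserved by every \<zeta>_k-derivative with k in \<open>{1..n}\<close>:
  the function is still an integral of the same \<open>g\<close> against tempered functions. For
  admissible \<open>g\<close> it supplies derivatives of all orders without new estimates.\<close>

definition smooth :: "(real ^ 'n \<Rightarrow> cd) \<Rightarrow> (cd \<Rightarrow> cd) \<Rightarrow> bool" where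
  "smooth g \<Theta> \<longleftrightarrow> (\<exists>\<Phi>. (\<forall>b<2 ^ r. tempered n (\<Phi> b)) \<and> (\<forall>\<zeta>\<in>cd_params r n. \<Theta> \<zeta> = expansion g \<Phi> \<zeta>))"

section \<open>The transform as a finite sum of scalar integrals\<close>

lemma transform_integrand_eq:
  assumes "\<zeta> \<in> cd_params r n"
  shows "transform_integrand r u g p \<zeta> t i =
    (\<Sum>a<2 ^ r. \<Sum>b<2 ^ r. cd_mult r (cd_unit a) (cd_unit b) i *
      (g t a * (weight \<zeta> t * \<Psi> b (phase t \<zeta>))))"
  unfolding transform_integrand_def weight_def phase_def
  by (subst cd_mult_eq_sum) (simp add: cd_exp_kernel[OF assms])

lemma transform_converges_if_admissible:
  assumes "admissible g" "\<zeta> \<in> cd_params r n"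
  shows "transform_converges r u g p \<zeta>"
  using assms(1) unfolding transform_converges_def transform_integrand_eq[OF assms(2)] admissible_def
  by (auto intro!: Bochner_Integration.integrable_sum integrable_mult_right integrable_integrand tempered_\<Psi>)

lemma transform_eq_expansion:
  assumes "admissible g" "\<zeta> \<in> cd_params r n"
  shows "transform r u g p \<zeta> = expansion g \<Psi> \<zeta>"
proof -
  have "integrable lebesgue (\<lambda>t. g t a * (weight \<zeta> t * \<Psi> b (phase t \<zeta>)))" if "a < 2 ^ r" "b < 2 ^ r" for a b
    using assms(1) that unfolding admissible_def by (intro integrable_integrand tempered_\<Psi>) auto
  then show ?thesis
    unfolding transform_def transform_integrand_eq[OF assms(2)] expansion_def component_def
    by (intro ext has_bochner_integral_integral_eq has_bochner_integral_sum
        has_bochner_integral_mult_right has_bochner_integral_integrable) simp_all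
qed

lemma smooth_transform: "admissible g \<Longrightarrow> smooth g (transform r u g p)"
  unfolding smooth_def using transform_eq_expansion tempered_\<Psi> by blast

lemma cd_shift_params: "\<lbrakk>\<zeta> \<in> cd_params r n; k \<in> {1..n}\<rbrakk> \<Longrightarrow> cd_shift k \<zeta> h \<in> cd_params r n"
  using n_less by (auto simp: cd_params_def cd_carrier_def cd_shift_def)

lemma pderiv_along_cd_shift_cong:
  assumes "\<forall>\<zeta>\<in>cd_params r n. G \<zeta> = H \<zeta>" "k \<in> {1..n}" "\<zeta> \<in> cd_params r n"
  shows "pderiv_along cd_shift k G \<zeta> = pderiv_along cd_shift k H \<zeta>"
  using assms cd_shift_params by (simp add: pderiv_along_def)

lemma DERIV_expansion:
  assumes g: "admissible g" and k: "k \<in> {1..n}"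
    and \<Phi>: "\<forall>b<2 ^ r. tempered n (\<Phi> b) \<and> tempered n (\<Phi>' b) \<and> partial_of k (\<Phi> b) (\<Phi>' b)"
  shows "((\<lambda>h. expansion g \<Phi> (cd_shift k \<zeta> h) i) has_real_derivative expansion g \<Phi>' \<zeta> i) (at 0)"
  unfolding expansion_def
  using assms by (intro DERIV_sum DERIV_cmult DERIV_component) (auto simp: admissible_def)

lemma partial_family:
  assumes "\<forall>b<2 ^ r. tempered n (\<Phi> b)" "k \<in> {1..n}"
  obtains \<Phi>' where "\<forall>b<2 ^ r. tempered n (\<Phi> b) \<and> tempered n (\<Phi>' b) \<and> partial_of k (\<Phi> b) (\<Phi>' b)"
proof -
  have "\<forall>b. \<exists>\<Phi>'. b < 2 ^ r \<longrightarrow> tempered n \<Phi>' \<and> partial_of k (\<Phi> b) \<Phi>'"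
    using assms tempered_partial by blast
  then obtain \<Phi>' where "\<forall>b. b < 2 ^ r \<longrightarrow> tempered n (\<Phi>' b) \<and> partial_of k (\<Phi> b) (\<Phi>' b)"
    unfolding choice_iff by blast
  then show thesis using that assms(1) by blast
qed

lemma pderiv_along_expansion:
  assumes g: "admissible g" and k: "k \<in> {1..n}"
    and \<Phi>: "\<forall>b<2 ^ r. tempered n (\<Phi> b) \<and> tempered n (\<Phi>' b) \<and> partial_of k (\<Phi> b) (\<Phi>' b)"
    and \<Theta>: "\<forall>\<zeta>\<in>cd_params r n. \<Theta> \<zeta> = expansion g \<Phi> \<zeta>" and \<zeta>: "\<zeta> \<in> cd_params r n"
  shows "pderiv_along cd_shift k \<Theta> \<zeta> = expansion g \<Phi>' \<zeta>"
    and "(\<lambda>h. \<Theta> (cd_shift k \<zeta> h) i) field_differentiable at 0"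
proof -
  have *: "((\<lambda>h. \<Theta> (cd_shift k \<zeta> h) i) has_real_derivative expansion g \<Phi>' \<zeta> i) (at 0)" for i
    using DERIV_expansion[OF g k \<Phi>, of \<zeta> i] \<Theta> cd_shift_params[OF \<zeta> k] by simp
  then show "pderiv_along cd_shift k \<Theta> \<zeta> = expansion g \<Phi>' \<zeta>"
    unfolding pderiv_along_def by (intro ext DERIV_imp_deriv)
  show "(\<lambda>h. \<Theta> (cd_shift k \<zeta> h) i) field_differentiable at 0"
    using * unfolding field_differentiable_def by blast
qed

lemma smooth_pderiv_along:
  assumes g: "admissible g" and k: "k \<in> {1..n}" and \<Theta>: "smooth g \<Theta>"
  shows "smooth g (pderiv_along cd_shift k \<Theta>)"
    and "pdifferentiable_along cd_shift (cd_params r n) k \<Theta>"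
proof -
  obtain \<Phi> where "\<forall>b<2 ^ r. tempered n (\<Phi> b)" and \<Phi>: "\<forall>\<zeta>\<in>cd_params r n. \<Theta> \<zeta> = expansion g \<Phi> \<zeta>"
    using \<Theta> unfolding smooth_def by blast
  then obtain \<Phi>' where \<Phi>': "\<forall>b<2 ^ r. tempered n (\<Phi> b) \<and> tempered n (\<Phi>' b) \<and> partial_of k (\<Phi> b) (\<Phi>' b)"
    using partial_family k by blast
  note D = pderiv_along_expansion[OF g k \<Phi>' \<Phi>]
  show "smooth g (pderiv_along cd_shift k \<Theta>)"
    unfolding smooth_def using D(1) \<Phi>' by blast
  show "pdifferentiable_along cd_shift (cd_params r n) k \<Theta>"
    unfolding pdifferentiable_along_def using D(2) by blast
qed

lemma smooth_mult:
  assumes "smooth g \<Theta>"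
  shows "smooth g (\<lambda>\<zeta> i. c * \<Theta> \<zeta> i)"
proof -
  obtain \<Phi> where "\<forall>b<2 ^ r. tempered n (\<Phi> b)" and \<Phi>: "\<forall>\<zeta>\<in>cd_params r n. \<Theta> \<zeta> = expansion g \<Phi> \<zeta>"
    using assms unfolding smooth_def by blast
  have "c * expansion g \<Phi> \<zeta> i = expansion g (\<lambda>b \<psi>. c * \<Phi> b \<psi>) \<zeta> i" for \<zeta> i
    by (simp add: expansion_def component_def sum_distrib_left mult.left_commute[of _ c])
  then show ?thesis
    unfolding smooth_def using \<Phi> \<open>\<forall>b<2 ^ r. tempered n (\<Phi> b)\<close>
    by (intro exI[of _ "\<lambda>b \<psi>. c * \<Phi> b \<psi>"]) (auto intro: tempered.intros)
qed

lemma smooth_pS_op: "\<lbrakk>admissible g; k \<in> {1..n}; smooth g \<Theta>\<rbrakk> \<Longrightarrow> smooth g (pS_op p k \<Theta>)"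
  using smooth_mult[OF smooth_pderiv_along(1), of g k \<Theta> "- p k"] by (simp add: pS_op_def S_op_def)

lemma smooth_pderiv_along_funpow:
  assumes "admissible g" "k \<in> {1..n}" "smooth g \<Theta>"
  shows "smooth g ((pderiv_along cd_shift k ^^ l) \<Theta>)"
  by (induction l) (use assms smooth_pderiv_along(1) in auto)

lemma smooth_pS_op_funpow:
  assumes "admissible g" "k \<in> {1..n}" "smooth g \<Theta>"
  shows "smooth g ((pS_op p k ^^ l) \<Theta>)"
  by (induction l) (use assms smooth_pS_op in auto)

lemma mixed_pderiv_exists_transform:
  assumes "admissible g"
  shows "mixed_pderiv_exists cd_shift (cd_params r n) n m (transform r u g p)"
proof -
  have *: "smooth g (foldr (\<lambda>k. pderiv_along cd_shift k ^^ m k) ks (transform r u g p))"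
    if "set ks \<subseteq> {1..n}" for ks
    using that by (induction ks) (auto intro: smooth_transform smooth_pderiv_along_funpow assms)
  show ?thesis
    unfolding mixed_pderiv_exists_def
    by (intro ballI allI impI smooth_pderiv_along(2)[OF assms] smooth_pderiv_along_funpow assms *)
       (auto simp del: upt_Suc)
qed

section \<open>The differentiation formula\<close>

lemma pS_op_cong:
  "\<lbrakk>\<forall>\<zeta>\<in>cd_params r n. G \<zeta> = H \<zeta>; k \<in> {1..n}; \<zeta> \<in> cd_params r n\<rbrakk> \<Longrightarrow> pS_op p k G \<zeta> = pS_op p k H \<zeta>"
  by (simp add: pS_op_def S_op_def pderiv_along_cd_shift_cong[of G H])

lemma D_op_cong:
  "\<lbrakk>\<forall>\<zeta>\<in>cd_params r n. G \<zeta> = H \<zeta>; k \<in> {1..n}; \<zeta> \<in> cd_params r n\<rbrakk> \<Longrightarrow> D_op \<sigma> p k G \<zeta> = D_op \<sigma> p k H \<zeta>"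
  by (simp add: D_op_def pS_op_cong[of G H])

text \<open>The scalar integration by parts is summed over the structure constants; the sign of p_k
  fits because \<open>S_op\<close> is minus the derivative in \<zeta>_k.\<close>

lemma transform_directional_derivative:
  assumes g: "admissible g" "admissible g'" and k: "k \<in> {1..n}"
    and D: "\<And>t a. ((\<lambda>h. g (t + h *\<^sub>R d k) a) has_real_derivative g' t a) (at 0)"
    and \<zeta>: "\<zeta> \<in> cd_params r n"
  shows "transform r u g' p \<zeta> = D_op \<sigma> p k (transform r u g p) \<zeta>"
proof
  fix i
  obtain \<Psi>' where \<Psi>': "\<forall>b<2 ^ r. tempered n (\<Psi> b) \<and> tempered n (\<Psi>' b) \<and> partial_of k (\<Psi> b) (\<Psi>' b)"
    using partial_family[OF _ k] tempered_\<Psi> by blast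
  have "component (\<lambda>t. g' t a) (\<Psi> b) \<zeta> =
      \<sigma> k * p 0 * component (\<lambda>t. g t a) (\<Psi> b) \<zeta> - p k * component (\<lambda>t. g t a) (\<Psi>' b) \<zeta>"
    if "a < 2 ^ r" "b < 2 ^ r" for a b
    using g \<Psi>' that by (intro component_directional_derivative D k) (auto simp: admissible_def)
  then have "expansion g' \<Psi> \<zeta> i = (\<Sum>a<2 ^ r. \<Sum>b<2 ^ r. cd_mult r (cd_unit a) (cd_unit b) i *
      (\<sigma> k * p 0 * component (\<lambda>t. g t a) (\<Psi> b) \<zeta> - p k * component (\<lambda>t. g t a) (\<Psi>' b) \<zeta>))"
    unfolding expansion_def by (intro sum.cong refl) simp
  also have "\<dots> = \<sigma> k * p 0 * expansion g \<Psi> \<zeta> i - p k * expansion g \<Psi>' \<zeta> i"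
    unfolding expansion_def sum_distrib_left right_diff_distrib sum_subtractf by (simp only: mult_ac)
  finally have *: "expansion g' \<Psi> \<zeta> i = \<sigma> k * p 0 * expansion g \<Psi> \<zeta> i - p k * expansion g \<Psi>' \<zeta> i" .
  show "transform r u g' p \<zeta> i = D_op \<sigma> p k (transform r u g p) \<zeta> i"
    using pderiv_along_expansion(1)[OF g(1) k \<Psi>' _ \<zeta>, of "transform r u g p"]
    by (simp add: D_op_def pS_op_def S_op_def transform_eq_expansion g \<zeta> *)
qed

text \<open>Induction along the chain of partial derivatives, from the innermost outwards, carrying
  admissibility together with the formula. The operators are stacked in the same order on both
  sides, so no derivatives are interchanged. Each step integrates by parts and needs domination of
  the function and of its derivative, hence of all intermediate stages.\<close>

lemma transform_mixed_pderiv: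
  assumes g: "admissible g"
    and ex: "mixed_pderiv_exists (dir_shift d) UNIV n m g"
    and dom: "\<And>k l a. \<lbrakk>k \<in> {1..n}; l \<le> m k; a < 2 ^ r\<rbrakk> \<Longrightarrow> dominated (\<lambda>t.
      (pderiv_along (dir_shift d) k ^^ l) (foldr (\<lambda>k. pderiv_along (dir_shift d) k ^^ m k) [Suc k..<Suc n] g) t a)"
  shows "admissible (mixed_pderiv (dir_shift d) n m g)"
    and "\<zeta> \<in> cd_params r n \<Longrightarrow> transform r u (mixed_pderiv (dir_shift d) n m g) p \<zeta> =
      foldr (\<lambda>k. D_op \<sigma> p k ^^ m k) [1..<Suc n] (transform r u g p) \<zeta>"
proof -
  define P where "P h G \<longleftrightarrow> admissible h \<and> (\<forall>\<zeta>\<in>cd_params r n. transform r u h p \<zeta> = G \<zeta>)" for h G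
  let ?D = "pderiv_along (dir_shift d)"
  let ?f = "\<lambda>k. foldr (\<lambda>k. ?D k ^^ m k) [Suc k..<Suc n] g"
  let ?F = "\<lambda>k. foldr (\<lambda>k. D_op \<sigma> p k ^^ m k) [Suc k..<Suc n] (transform r u g p)"
  have chain: "P ((?D k ^^ l) (?f k)) ((D_op \<sigma> p k ^^ l) (?F k))"
    if k: "k \<in> {1..n}" and P: "P (?f k) (?F k)" and l: "l \<le> m k" for k l
    using l
  proof (induction l)
    case (Suc l)
    let ?h = "(?D k ^^ l) (?f k)" and ?G = "(D_op \<sigma> p k ^^ l) (?F k)"
    have "P ?h ?G" using Suc by simp
    then have h: "admissible ?h" and G: "\<forall>\<zeta>\<in>cd_params r n. transform r u ?h p \<zeta> = ?G \<zeta>"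
      unfolding P_def by blast+
    have "pdifferentiable_along (dir_shift d) UNIV k ?h"
      using ex k Suc.prems unfolding mixed_pderiv_exists_def by simp
    then have D: "((\<lambda>h. ?h (t + h *\<^sub>R d k) a) has_real_derivative ?D k ?h t a) (at 0)" for t a
      unfolding pdifferentiable_along_def pderiv_along_def dir_shift_def
      by (simp add: DERIV_deriv_iff_field_differentiable)
    have "admissible (?D k ?h)"
      unfolding admissible_def
    proof (intro allI impI conjI)
      fix a :: nat assume a: "a < 2 ^ r"
      show "dominated (\<lambda>t. ?D k ?h t a)"
        using dom[OF k Suc.prems a] by simp
      have "(\<lambda>t. ?h (t + h *\<^sub>R d k) a) \<in> borel_measurable lebesgue" for h
        using measurable_compose[OF measurable_translation_lebesgue[of "h *\<^sub>R d k"], of "\<lambda>t. ?h t a" borel] h a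
        by (simp add: add.commute admissible_def)
      then show "(\<lambda>t. ?D k ?h t a) \<in> borel_measurable lebesgue"
        using D by (rule measurable_DERIV)
    qed
    with h have "transform r u (?D k ?h) p \<zeta> = D_op \<sigma> p k ?G \<zeta>" if "\<zeta> \<in> cd_params r n" for \<zeta>
      using transform_directional_derivative[OF h _ k D that] D_op_cong[OF G k that] by simp
    then show ?case
      using \<open>admissible (?D k ?h)\<close> unfolding P_def by simp
  qed (use P in simp)
  \<comment> \<open>Downward induction: at k = n the remaining list is empty, and k = 0 gives the
    full chain.\<close>
  have "P (?f k) (?F k)" if "k \<le> n" for k
    using that
  proof (induction rule: inc_induct)
    case base
    then show ?case using g by (simp add: P_def)
  next
    case (step k)
    then have "[Suc k..<Suc n] = Suc k # [Suc (Suc k)..<Suc n]"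
      by (simp add: upt_conv_Cons del: upt_Suc)
    then show ?case
      using \<open>P (?f (Suc k)) (?F (Suc k))\<close> step.hyps
        chain[of "Suc k" "m (Suc k)"]
      by (simp del: upt_Suc)
  qed
  from this[of 0] show "admissible (mixed_pderiv (dir_shift d) n m g)"
    and "\<zeta> \<in> cd_params r n \<Longrightarrow> transform r u (mixed_pderiv (dir_shift d) n m g) p \<zeta> =
      foldr (\<lambda>k. D_op \<sigma> p k ^^ m k) [1..<Suc n] (transform r u g p) \<zeta>"
    unfolding P_def mixed_pderiv_def by (simp_all del: upt_Suc)
qed

text \<open>The binomial theorem for multiplication by p_0 and p_k S_k, which commute because p_0
  does not depend on \<zeta>. Smoothness permits differentiating the finite sum term by
  term.\<close>

lemma p0_pS_op_funpow:
  assumes g: "admissible g" and k: "k \<in> {1..n}" and \<Theta>: "smooth g \<Theta>" and \<zeta>: "\<zeta> \<in> cd_params r n"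
  shows "(p0_pS_op p k ^^ l) \<Theta> \<zeta> i =
    (\<Sum>q = 0..l. real (l choose q) * p 0 ^ (l - q) * (pS_op p k ^^ q) \<Theta> \<zeta> i)"
  using \<zeta>
proof (induction l arbitrary: \<zeta> i)
  case (Suc l)
  let ?A = "\<lambda>q. (pS_op p k ^^ q) \<Theta>"
  let ?c = "\<lambda>l q. real (l choose q) * p 0 ^ (l - q)"
  let ?G = "\<lambda>\<zeta> i. \<Sum>q = 0..l. ?c l q * ?A q \<zeta> i"
  have "((\<lambda>h. ?A q (cd_shift k \<zeta> h) i) has_real_derivative pderiv_along cd_shift k (?A q) \<zeta> i) (at 0)" for q
    using smooth_pderiv_along(2)[OF g k smooth_pS_op_funpow[OF g k \<Theta>], of q] Suc.prems
    unfolding pderiv_along_def pdifferentiable_along_def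
    by (simp add: DERIV_deriv_iff_field_differentiable)
  then have "((\<lambda>h. ?G (cd_shift k \<zeta> h) i) has_real_derivative
      (\<Sum>q = 0..l. ?c l q * pderiv_along cd_shift k (?A q) \<zeta> i)) (at 0)"
    by (intro DERIV_sum DERIV_cmult)
  then have "pderiv_along cd_shift k ?G \<zeta> i = (\<Sum>q = 0..l. ?c l q * pderiv_along cd_shift k (?A q) \<zeta> i)"
    unfolding pderiv_along_def by (rule DERIV_imp_deriv)
  then have pS: "pS_op p k ?G \<zeta> i = (\<Sum>q = 0..l. ?c l q * ?A (Suc q) \<zeta> i)"
    by (simp add: pS_op_def S_op_def sum_distrib_left mult_ac flip: sum_negf)
  have eq: "\<forall>\<zeta>\<in>cd_params r n. (p0_pS_op p k ^^ l) \<Theta> \<zeta> = ?G \<zeta>"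
    using Suc.IH by blast
  have "(p0_pS_op p k ^^ Suc l) \<Theta> \<zeta> i =
      p 0 * (p0_pS_op p k ^^ l) \<Theta> \<zeta> i + pS_op p k ((p0_pS_op p k ^^ l) \<Theta>) \<zeta> i"
    by (simp add: p0_pS_op_def)
  also have "\<dots> = p 0 * ?G \<zeta> i + pS_op p k ?G \<zeta> i"
    unfolding pS_op_cong[OF eq k Suc.prems] bspec[OF eq Suc.prems] ..
  also have "\<dots> = (\<Sum>q = 0..l. ?c l q * p 0 * ?A q \<zeta> i) + (\<Sum>q = 0..l. ?c l q * ?A (Suc q) \<zeta> i)"
    unfolding pS by (simp add: sum_distrib_left mult_ac)
  \<comment> \<open>The sum is extended to q = l + 1, where the binomial coefficient vanishes; after
    an index shift Pascal's rule merges the two sums.\<close>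
  also have "(\<Sum>q = 0..l. ?c l q * p 0 * ?A q \<zeta> i) = (\<Sum>q = 0..Suc l. real (l choose q) * p 0 ^ (Suc l - q) * ?A q \<zeta> i)"
    by (simp add: Suc_diff_le mult_ac binomial_eq_0)
  also have "\<dots> = p 0 ^ Suc l * \<Theta> \<zeta> i + (\<Sum>q = 0..l. real (l choose Suc q) * p 0 ^ (l - q) * ?A (Suc q) \<zeta> i)"
    by (subst sum.atLeast0_atMost_Suc_shift) simp
  also have "\<dots> + (\<Sum>q = 0..l. ?c l q * ?A (Suc q) \<zeta> i) =
      (\<Sum>q = 0..Suc l. ?c (Suc l) q * ?A q \<zeta> i)"
    by (subst sum.atLeast0_atMost_Suc_shift) (simp add: algebra_simps flip: sum.distrib)
  finally show ?case .
qed simp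

end

section \<open>Mixed derivatives\<close>

lemma foldr_eq_self: "(\<And>x. x \<in> set xs \<Longrightarrow> F x g = g) \<Longrightarrow> foldr F xs g = g"
  by (induction xs) auto

text \<open>Elements of \<open>multi_below\<close> vanish outside \<open>{1..n}\<close>, whereas
  \<open>j\<close> is arbitrary there; this lets \<open>j\<close> be replaced by its
  truncation.\<close>

lemma mixed_pderiv_cong:
  assumes "\<And>k. k \<in> {1..n} \<Longrightarrow> m k = m' k"
  shows "mixed_pderiv sh n m = mixed_pderiv sh n m'"
    and "mixed_pderiv_exists sh X n m = mixed_pderiv_exists sh X n m'"
proof -
  have fold: "foldr (\<lambda>k. pderiv_along sh k ^^ m k) ks g = foldr (\<lambda>k. pderiv_along sh k ^^ m' k) ks g"
    if "set ks \<subseteq> {1..n}" for ks g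
    using that assms by (intro foldr_cong) auto
  show "mixed_pderiv sh n m = mixed_pderiv sh n m'"
    by (rule ext, unfold mixed_pderiv_def, rule fold) auto
  have "foldr (\<lambda>k. pderiv_along sh k ^^ m k) [Suc k..<Suc n] g =
      foldr (\<lambda>k. pderiv_along sh k ^^ m' k) [Suc k..<Suc n] g" for k g
    by (rule fold) auto
  then show "mixed_pderiv_exists sh X n m = mixed_pderiv_exists sh X n m'"
    using assms by (intro ext) (simp add: mixed_pderiv_exists_def del: upt_Suc)
qed

text \<open>Each intermediate stage of the chain is itself a full mixed derivative, below
  \<open>m\<close> if l \<le> m k, so the growth hypotheses over \<open>multi_below\<close> apply to
  it.\<close>

lemma mixed_pderiv_partial:
  assumes "k \<in> {1..n}"
  shows "mixed_pderiv sh n (\<lambda>i. if i = k then l else if i \<in> {Suc k..n} then m i else 0) g =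
    (pderiv_along sh k ^^ l) (foldr (\<lambda>k. pderiv_along sh k ^^ m k) [Suc k..<Suc n] g)"
proof -
  have "[1..<Suc n] = [1..<k] @ k # [Suc k..<Suc n]"
    using assms upt_add_eq_append[of 1 k "Suc n - k"] by (simp add: upt_conv_Cons del: upt_Suc)
  moreover have "foldr (\<lambda>i. pderiv_along sh i ^^ (if i = k then l else if i \<in> {Suc k..n} then m i else 0))
      [Suc k..<Suc n] g = foldr (\<lambda>k. pderiv_along sh k ^^ m k) [Suc k..<Suc n] g"
    by (intro foldr_cong) auto
  moreover have "foldr (\<lambda>i. pderiv_along sh i ^^ (if i = k then l else if i \<in> {Suc k..n} then m i else 0))
      [1..<k] h = h" for h
    by (rule foldr_eq_self) auto
  ultimately show ?thesis
    unfolding mixed_pderiv_def by (simp del: upt_Suc)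
qed

text \<open>A map that carries one family of shifts to another intertwines the derivatives. With
  \<open>t_of_s\<close> this turns derivatives in s into directional derivatives in t.\<close>

lemma pderiv_along_comp:
  assumes "\<And>k x h. T (sh k x h) = sh' k (T x) h"
  shows "pderiv_along sh k (g \<circ> T) = pderiv_along sh' k g \<circ> T"
  by (simp add: pderiv_along_def assms fun_eq_iff)

lemma pderiv_along_funpow_comp:
  assumes "\<And>k x h. T (sh k x h) = sh' k (T x) h"
  shows "(pderiv_along sh k ^^ l) (g \<circ> T) = (pderiv_along sh' k ^^ l) g \<circ> T"
proof (induction l)
  case (Suc l)
  then show ?case
    using pderiv_along_comp[of T sh sh' k "(pderiv_along sh' k ^^ l) g", OF assms]
    by (simp add: comp_def)
qed simp

lemma foldr_pderiv_along_comp: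
  assumes "\<And>k x h. T (sh k x h) = sh' k (T x) h"
  shows "foldr (\<lambda>k. pderiv_along sh k ^^ m k) ks (g \<circ> T) =
    foldr (\<lambda>k. pderiv_along sh' k ^^ m k) ks g \<circ> T"
proof (induction ks)
  case (Cons k ks)
  then show ?case
    using pderiv_along_funpow_comp[of T sh sh' "m k" k
        "foldr (\<lambda>k. pderiv_along sh' k ^^ m k) ks g", OF assms]
    by (simp add: comp_def)
qed simp

lemma mixed_pderiv_comp:
  assumes "\<And>k x h. T (sh k x h) = sh' k (T x) h"
  shows "mixed_pderiv sh n m (g \<circ> T) = mixed_pderiv sh' n m g \<circ> T"
  unfolding mixed_pderiv_def by (rule foldr_pderiv_along_comp) (rule assms)

lemma mixed_pderiv_exists_comp:
  assumes "\<And>k x h. T (sh k x h) = sh' k (T x) h" and "surj T"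
    and "mixed_pderiv_exists sh UNIV n m (g \<circ> T)"
  shows "mixed_pderiv_exists sh' UNIV n m g"
proof -
  have "pdifferentiable_along sh' UNIV k h" if "pdifferentiable_along sh UNIV k (h \<circ> T)" for k h
    unfolding pdifferentiable_along_def
  proof (intro ballI allI)
    fix x i
    obtain y where "x = T y"
      using \<open>surj T\<close> by (rule surjE)
    then show "(\<lambda>s. h (sh' k x s) i) field_differentiable at 0"
      using that by (simp add: pdifferentiable_along_def assms(1))
  qed
  then show ?thesis
    using assms(3) unfolding mixed_pderiv_exists_def
      foldr_pderiv_along_comp[of T sh sh', OF assms(1)] pderiv_along_funpow_comp[of T sh sh', OF assms(1)]
    by blast
qed

text \<open>Finiteness makes \<open>Max\<close> and \<open>Min\<close> over the growth exponents
  genuine bounds for each of them.\<close>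

lemma finite_multi_below: "finite (multi_below n j)"
proof (rule finite_subset)
  show "multi_below n j \<subseteq> {m. \<forall>l. (l \<in> {1..n} \<longrightarrow> m l \<in> {..Max (j ` {1..n})}) \<and> (l \<notin> {1..n} \<longrightarrow> m l = 0)}"
    unfolding multi_below_def by (fastforce intro: order_trans[OF _ Max_ge])
qed (rule finite_set_of_finite_funs; simp)

context phase_kernel
begin

text \<open>In the orthant of t the exponent consists of (A - p_0) t_i for nonnegative and (B - p_0)
  t_i for negative coordinates, so there is decay at the rate \<epsilon>, the distance from p_0 to
  the nearer of A and B.\<close>

lemma exp_growth_imp_dominated:
  assumes growth: "exp_growth r A B g" and AB: "A < p 0" "p 0 < B" and a: "a < 2 ^ r"
  shows "dominated (\<lambda>t. g t a)"
proof -
  define V where "V = {v :: 'n \<Rightarrow> real. range v \<subseteq> {-1, 1}}"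
  have "finite (PiE (UNIV :: 'n set) (\<lambda>_. {-1, 1 :: real}))"
    by (intro finite_PiE) auto
  then have fin: "finite V"
    by (rule rev_finite_subset) (auto simp: V_def PiE_def)
  have "\<forall>v\<in>V. \<exists>C. C > 0 \<and> (\<forall>t. (\<forall>i. v i * t $ i \<ge> 0) \<longrightarrow>
      cd_norm r (g t) < C * exp (\<Sum>i\<in>UNIV. (if v i = 1 then A else B) * t $ i))"
    using growth unfolding exp_growth_def V_def by blast
  from bchoice[OF this] obtain C where *: "\<forall>v\<in>V. C v > 0 \<and> (\<forall>t. (\<forall>i. v i * t $ i \<ge> 0) \<longrightarrow>
      cd_norm r (g t) < C v * exp (\<Sum>i\<in>UNIV. (if v i = 1 then A else B) * t $ i))" ..
  then have C: "\<And>v. v \<in> V \<Longrightarrow> 0 < C v" by blast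
  have bound: "cd_norm r (g t) < C v * exp (\<Sum>i\<in>UNIV. (if v i = 1 then A else B) * t $ i)"
    if "v \<in> V" "\<forall>i. v i * t $ i \<ge> 0" for v t
    using * that by blast
  define \<epsilon> where "\<epsilon> = min (p 0 - A) (B - p 0)"
  have \<epsilon>: "0 < \<epsilon>" using AB by (simp add: \<epsilon>_def)
  have "\<bar>g t a * exp (- (p 0 * (\<Sum>i\<in>UNIV. t $ i)))\<bar> \<le> sum C V * exp (- \<epsilon> * (\<Sum>i\<in>UNIV. \<bar>t $ i\<bar>))" for t
  proof -
    define v :: "'n \<Rightarrow> real" where "v = (\<lambda>i. if t $ i \<ge> 0 then 1 else - 1)"
    have v: "v \<in> V" by (auto simp: V_def v_def)
    have "\<forall>i. v i * t $ i \<ge> 0"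
      by (simp add: v_def)
    then have "\<bar>g t a\<bar> \<le> C v * exp (\<Sum>i\<in>UNIV. (if v i = 1 then A else B) * t $ i)"
      using abs_nth_le_cd_norm[OF a, of "g t"] bound[OF v] by force
    \<comment> \<open>The sum of the positive constants over all sign patterns replaces the constant
      of the orthant.\<close>
    also have "\<dots> \<le> sum C V * exp (\<Sum>i\<in>UNIV. (if v i = 1 then A else B) * t $ i)"
      using C v fin by (intro mult_right_mono member_le_sum) (auto intro: less_imp_le)
    finally have "\<bar>g t a * exp (- (p 0 * (\<Sum>i\<in>UNIV. t $ i)))\<bar> \<le>
        sum C V * exp (\<Sum>i\<in>UNIV. (if v i = 1 then A else B) * t $ i) * exp (- (p 0 * (\<Sum>i\<in>UNIV. t $ i)))"
      by (simp add: abs_mult)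
    also have "\<dots> = sum C V * exp (\<Sum>i\<in>UNIV. ((if v i = 1 then A else B) - p 0) * t $ i)"
      unfolding mult.assoc exp_add[symmetric]
      by (simp add: sum_distrib_left left_diff_distrib sum_subtractf)
    also have "\<dots> \<le> sum C V * exp (- \<epsilon> * (\<Sum>i\<in>UNIV. \<bar>t $ i\<bar>))"
    proof -
      have "((if v i = 1 then A else B) - p 0) * t $ i \<le> - \<epsilon> * \<bar>t $ i\<bar>" for i
      proof (cases "t $ i \<ge> 0")
        case True
        then have "\<epsilon> * t $ i \<le> (p 0 - A) * t $ i"
          by (intro mult_right_mono) (simp_all add: \<epsilon>_def)
        then show ?thesis using True by (simp add: v_def algebra_simps)
      next
        case False
        then have "\<epsilon> * - t $ i \<le> (B - p 0) * - t $ i"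
          by (intro mult_right_mono) (simp_all add: \<epsilon>_def)
        then show ?thesis using False by (simp add: v_def algebra_simps)
      qed
      then have "(\<Sum>i\<in>UNIV. ((if v i = 1 then A else B) - p 0) * t $ i) \<le> - \<epsilon> * (\<Sum>i\<in>UNIV. \<bar>t $ i\<bar>)"
        unfolding sum_distrib_left by (rule sum_mono)
      then show ?thesis
        using C by (intro mult_left_mono) (auto intro: sum_nonneg less_imp_le)
    qed
    finally show ?thesis .
  qed
  then show ?thesis
    unfolding dominated_def exp_decay_def using \<epsilon> by blast
qed

lemma transform_derivative_formula:
  assumes f: "is_original r f"
    and hyp: "\<forall>m\<in>multi_below n j. mixed_pderiv_exists (dir_shift d) UNIV n m f \<and>
      exp_growth r (a m) (b m) (mixed_pderiv (dir_shift d) n m f)"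
    and p: "Max (a ` multi_below n j) < p 0" "p 0 < Min (b ` multi_below n j)"
    and \<zeta>: "\<zeta> \<in> cd_params r n"
  shows "admissible f" and "transform_converges r u f p \<zeta>"
    and "transform_converges r u (mixed_pderiv (dir_shift d) n j f) p \<zeta>"
    and "mixed_pderiv_exists cd_shift (cd_params r n) n m (transform r u f p)"
    and "transform r u (mixed_pderiv (dir_shift d) n j f) p \<zeta> =
      foldr (\<lambda>k. D_op \<sigma> p k ^^ j k) [1..<Suc n] (transform r u f p) \<zeta>"
proof -
  have dom: "dominated (\<lambda>t. mixed_pderiv (dir_shift d) n m f t c)" if "m \<in> multi_below n j" "c < 2 ^ r" for m c
  proof (rule exp_growth_imp_dominated)
    show "exp_growth r (a m) (b m) (mixed_pderiv (dir_shift d) n m f)"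
      using hyp that by blast
    have "a m \<le> Max (a ` multi_below n j)" "Min (b ` multi_below n j) \<le> b m"
      using that finite_multi_below by auto
    with p show "a m < p 0" "p 0 < b m" by auto
  qed fact
  have "(\<lambda>t. f t c) \<in> borel_measurable lebesgue" for c
  proof (rule AE_isCont_imp_measurable)
    have "AE t in lebesgue. isCont f t"
      using f unfolding is_original_def by blast
    then show "AE t in lebesgue. isCont (\<lambda>t. f t c) t"
    proof eventually_elim
      case (elim t)
      have "continuous_on UNIV (\<lambda>z :: cd. z c)"
        by (rule continuous_on_product_coordinates)
      then have "isCont (\<lambda>z :: cd. z c) (f t)"
        unfolding continuous_on_eq_continuous_at[OF open_UNIV] by blast
      with elim show ?case by (rule isCont_o2)
    qed
  qed
  \<comment> \<open>The derivative of multi-index 0 is \<open>f\<close> itself, so a growth bound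
    for \<open>f\<close> is among the hypotheses.\<close>
  moreover have "(\<lambda>_. 0) \<in> multi_below n j"
    by (simp add: multi_below_def)
  then have "dominated (\<lambda>t. f t c)" if "c < 2 ^ r" for c
    using dom[OF \<open>(\<lambda>_. 0) \<in> multi_below n j\<close> that]
    by (simp add: mixed_pderiv_def foldr_eq_self del: upt_Suc)
  ultimately show f_adm: "admissible f"
    unfolding admissible_def by blast
  have "(\<lambda>l. if l \<in> {1..n} then j l else 0) \<in> multi_below n j"
    by (simp add: multi_below_def)
  then have "mixed_pderiv_exists (dir_shift d) UNIV n (\<lambda>l. if l \<in> {1..n} then j l else 0) f"
    using hyp by blast
  also have "mixed_pderiv_exists (dir_shift d) UNIV n (\<lambda>l. if l \<in> {1..n} then j l else 0) =
      mixed_pderiv_exists (dir_shift d) UNIV n j"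
    by (rule mixed_pderiv_cong) simp
  finally have ex: "mixed_pderiv_exists (dir_shift d) UNIV n j f" .
  have "dominated (\<lambda>t. (pderiv_along (dir_shift d) k ^^ l)
      (foldr (\<lambda>k. pderiv_along (dir_shift d) k ^^ j k) [Suc k..<Suc n] f) t c)"
    if "k \<in> {1..n}" "l \<le> j k" "c < 2 ^ r" for k l c
    unfolding mixed_pderiv_partial[OF that(1), symmetric]
    using that by (intro dom) (auto simp: multi_below_def)
  note formula = transform_mixed_pderiv[OF f_adm ex this]
  show "transform_converges r u f p \<zeta>"
    "transform_converges r u (mixed_pderiv (dir_shift d) n j f) p \<zeta>"
    by (intro transform_converges_if_admissible f_adm formula(1) \<zeta>; assumption)+
  show "mixed_pderiv_exists cd_shift (cd_params r n) n m (transform r u f p)"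
    by (rule mixed_pderiv_exists_transform[OF f_adm])
  show "transform r u (mixed_pderiv (dir_shift d) n j f) p \<zeta> =
      foldr (\<lambda>k. D_op \<sigma> p k ^^ j k) [1..<Suc n] (transform r u f p) \<zeta>"
    using formula(2) \<zeta> by blast
qed

lemma p0_pS_op_funpow_transform:
  assumes f: "admissible f" and n: "1 \<le> n" and \<zeta>: "\<zeta> \<in> cd_params r n"
  shows "(p0_pS_op p 1 ^^ q) (foldr (\<lambda>l. pS_op p l ^^ j l) [2..<Suc n] (transform r u f p)) \<zeta> =
    (\<lambda>i. \<Sum>k = 0..q. real (q choose k) * p 0 ^ (q - k) *
      (pS_op p 1 ^^ k) (foldr (\<lambda>l. pS_op p l ^^ j l) [2..<Suc n] (transform r u f p)) \<zeta> i)"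
proof -
  have *: "smooth f (foldr (\<lambda>l. pS_op p l ^^ j l) ks (transform r u f p))" if "set ks \<subseteq> {1..n}" for ks
    using that by (induction ks) (auto intro: smooth_transform smooth_pS_op_funpow f)
  show ?thesis
    using n \<zeta> by (intro ext p0_pS_op_funpow[OF f] *) (auto simp del: upt_Suc)
qed

end

section \<open>The Cartesian and spherical kernels\<close>

lemma linear_coord: "linear (\<lambda>t. coord e t k)"
  by (rule linearI) (simp_all add: coord_def)

lemma linear_tail_sum: "linear (\<lambda>t. tail_sum e t k)"
  unfolding tail_sum_def by (intro linear_compose_sum ballI linear_coord)

lemma linear_t_of_s: "linear (t_of_s e)"
  by (rule linearI) (simp_all add: t_of_s_def coord_def vec_eq_iff algebra_simps)

context
  fixes e :: "nat \<Rightarrow> 'n::finite"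
  assumes e: "bij_betw e {1..CARD('n)} UNIV"
begin

section \<open>The coordinates t and s\<close>

lemma sum_coord: "(\<Sum>k = 1..CARD('n). h (coord e t k)) = (\<Sum>i\<in>UNIV. h (t $ i))"
proof -
  have "(\<Sum>k = 1..CARD('n). h (coord e t k)) = (\<Sum>k = 1..CARD('n). h (t $ e k))"
    by (intro sum.cong) (auto simp: coord_def)
  also have "\<dots> = (\<Sum>i\<in>UNIV. h (t $ i))"
    by (rule sum.reindex_bij_betw[OF e])
  finally show ?thesis .
qed

lemma tail_sum_1: "tail_sum e t 1 = (\<Sum>i\<in>UNIV. t $ i)"
  unfolding tail_sum_def by (rule sum_coord[where h = "\<lambda>x. x"])

lemma abs_tail_sum_le: "\<bar>tail_sum e t k\<bar> \<le> (\<Sum>i\<in>UNIV. \<bar>t $ i\<bar>)"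
proof -
  have "\<bar>tail_sum e t k\<bar> \<le> (\<Sum>l = k..CARD('n). \<bar>coord e t l\<bar>)"
    unfolding tail_sum_def by (rule sum_abs)
  also have "\<dots> = (\<Sum>l\<in>{k..CARD('n)} \<inter> {1..CARD('n)}. \<bar>coord e t l\<bar>)"
    by (rule sum.mono_neutral_right) (auto simp: coord_def)
  also have "\<dots> \<le> (\<Sum>l = 1..CARD('n). \<bar>coord e t l\<bar>)"
    by (rule sum_mono2) auto
  also have "\<dots> = (\<Sum>i\<in>UNIV. \<bar>t $ i\<bar>)"
    by (rule sum_coord[of abs])
  finally show ?thesis .
qed

lemma abs_coord_le: "\<bar>coord e t k\<bar> \<le> (\<Sum>i\<in>UNIV. \<bar>t $ i\<bar>)"
proof (cases "k \<in> {1..CARD('n)}")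
  case True
  then have "\<bar>coord e t k\<bar> \<le> (\<Sum>l = 1..CARD('n). \<bar>coord e t l\<bar>)"
    by (intro member_le_sum) auto
  then show ?thesis
    by (simp only: sum_coord[of abs])
next
  case False
  then have "coord e t k = 0"
    unfolding coord_def by (rule if_not_P)
  then show ?thesis
    by (simp add: sum_nonneg)
qed

lemma coord_axis: "\<lbrakk>k \<in> {1..CARD('n)}; l \<in> {1..CARD('n)}\<rbrakk> \<Longrightarrow>
    coord e (axis (e l) 1) k = (if k = l then 1 else 0)"
  using inj_on_eq_iff[OF bij_betw_imp_inj_on[OF e], of k l] by (simp add: coord_def axis_def)

lemma coord_vec: "k \<in> {1..CARD('n)} \<Longrightarrow> coord e (\<chi> i. h (inv_into {1..CARD('n)} e i)) k = h k"
  using bij_betw_inv_into_left[OF e] by (simp add: coord_def)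

lemma vec_eq_iff_coord: "s = t \<longleftrightarrow> (\<forall>k\<in>{1..CARD('n)}. coord e s k = coord e t k)"
proof
  assume *: "\<forall>k\<in>{1..CARD('n)}. coord e s k = coord e t k"
  have "s $ i = t $ i" for i
  proof -
    obtain k where "k \<in> {1..CARD('n)}" "i = e k"
      using bij_betw_imp_surj_on[OF e] by blast
    then show ?thesis
      using * by (auto simp: coord_def)
  qed
  then show "s = t" by (simp add: vec_eq_iff)
qed simp

lemma coord_t_of_s:
  "k \<in> {1..CARD('n)} \<Longrightarrow> coord e (t_of_s e s) k = coord e s k - coord e s (Suc k)"
  using bij_betw_inv_into_left[OF e] by (simp add: t_of_s_def coord_def)

lemma coord_s_of_t: "k \<in> {1..CARD('n)} \<Longrightarrow> coord e (s_of_t e t) k = tail_sum e t k"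
  unfolding s_of_t_def by (rule coord_vec)

lemma tail_sum_t_of_s:
  assumes "k \<in> {1..CARD('n)}"
  shows "tail_sum e (t_of_s e s) k = coord e s k"
proof -
  \<comment> \<open>A telescoping sum whose end term is s_(n+1), which \<open>coord\<close> sets to
    0.\<close>
  have "tail_sum e (t_of_s e s) k = - (\<Sum>l = k..CARD('n). coord e s (Suc l) - coord e s l)"
    unfolding tail_sum_def sum_negf[symmetric] using assms
    by (intro sum.cong) (auto simp: coord_t_of_s)
  also have "\<dots> = coord e s k - coord e s (Suc CARD('n))"
    using assms by (subst sum_Suc_diff) auto
  finally show ?thesis
    by (simp add: coord_def)
qed

lemma t_of_s_s_of_t: "t_of_s e (s_of_t e t) = t"
  unfolding vec_eq_iff_coord
proof
  fix k assume k: "k \<in> {1..CARD('n)}"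
  have "coord e (s_of_t e t) (Suc k) = tail_sum e t (Suc k)"
  \<comment> \<open>At k = n both sides are 0, the left by the default of \<open>coord\<close>, the
    right as an empty sum.\<close>
  proof (cases "Suc k \<in> {1..CARD('n)}")
    case False
    then show ?thesis
      by (simp add: coord_def tail_sum_def)
  qed (rule coord_s_of_t)
  then show "coord e (t_of_s e (s_of_t e t)) k = coord e t k"
    using k by (simp add: coord_t_of_s coord_s_of_t tail_sum_def sum.atLeast_Suc_atMost)
qed

text \<open>The direction is the unit vector of t_k minus that of t_(k-1), and the unit vector of
  t_1 alone for k = 1; its coordinate sum, 0 or 1, is the origin of \<sigma>.\<close>

lemma s_pderiv_eq:
  "s_pderiv e m f = mixed_pderiv (dir_shift (\<lambda>k. t_of_s e (axis (e k) 1))) CARD('n) m f"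
proof -
  have "t_of_s e (vec_shift e k s h) = dir_shift (\<lambda>k. t_of_s e (axis (e k) 1)) k (t_of_s e s) h" for k s h
    by (simp add: vec_shift_def dir_shift_def linear_add[OF linear_t_of_s] linear_scale[OF linear_t_of_s])
  from mixed_pderiv_comp[of "t_of_s e" "vec_shift e" "dir_shift (\<lambda>k. t_of_s e (axis (e k) 1))", OF this]
  show ?thesis
    by (simp add: s_pderiv_def t_pderiv_def t_of_s_s_of_t fun_eq_iff)
qed

lemma s_pderiv_exists_imp:
  assumes "s_pderiv_exists e m f"
  shows "mixed_pderiv_exists (dir_shift (\<lambda>k. t_of_s e (axis (e k) 1))) UNIV CARD('n) m f"
proof -
  have "t_of_s e (vec_shift e k s h) = dir_shift (\<lambda>k. t_of_s e (axis (e k) 1)) k (t_of_s e s) h" for k s h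
    by (simp add: vec_shift_def dir_shift_def linear_add[OF linear_t_of_s] linear_scale[OF linear_t_of_s])
  moreover have "surj (t_of_s e)"
    using t_of_s_s_of_t by (metis surjI)
  ultimately show ?thesis
    using assms unfolding s_pderiv_exists_def t_pderiv_exists_def by (rule mixed_pderiv_exists_comp)
qed

lemma vec_shift_eq: "vec_shift e = dir_shift (\<lambda>k. axis (e k) 1)"
  by (simp add: vec_shift_def dir_shift_def fun_eq_iff)

text \<open>With \<rho> the length of the phase vector, cos \<rho> and - (sin \<rho> / \<rho>)
  \<psi>_b become tempered through \<open>cos_root\<close> at \<rho>^2, although \<rho> is not
  differentiable at 0. The kernel has no components of index above n, hence the value 0
  there.\<close>

lemma phase_kernel_cart:
  assumes r: "CARD('n) < 2 ^ r"
  shows "phase_kernel r CARD('n) p (cart_kernel e) (\<lambda>k. axis (e k) 1) (\<lambda>k t. coord e t k) (\<lambda>_. 1)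
    (\<lambda>b \<psi>. if b = 0 then cos_root 0 (\<Sum>l = 1..CARD('n). (\<psi> l)\<^sup>2)
      else if b \<le> CARD('n) then 2 * \<psi> b * cos_root 1 (\<Sum>l = 1..CARD('n). (\<psi> l)\<^sup>2) else 0)"
    (is "phase_kernel _ ?n _ _ _ _ _ ?\<Psi>")
proof (rule phase_kernel.intro)
  show "?n < 2 ^ r" by fact
  show "linear (\<lambda>t. coord e t k)" for k by (rule linear_coord)
  show "coord e (axis (e l) 1) k = (if k = l then 1 else 0)" if "k \<in> {1..?n}" "l \<in> {1..?n}" for k l
    using that by (rule coord_axis)
  show "\<bar>coord e t k\<bar> \<le> (\<Sum>i\<in>UNIV. \<bar>t $ i\<bar>)" for k t by (rule abs_coord_le)
  show "(\<Sum>i\<in>UNIV. (axis (e k) 1 :: real ^ 'n) $ i) = 1" for k by (simp add: axis_def)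
  show "tempered ?n (?\<Psi> b)" for b
    by (intro tempered_if tempered.intros) simp
  fix \<zeta> t and b :: nat assume \<zeta>: "\<zeta> \<in> cd_params r ?n" and b: "b < 2 ^ r"
  define \<psi> where "\<psi> = (\<lambda>k. if k \<in> {1..?n} then p k * coord e t k + \<zeta> k else 0)"
  define z where "z = (\<lambda>k. - cart_kernel e p t \<zeta> k)"
  have z0: "z 0 = - (p 0 * (\<Sum>i\<in>UNIV. t $ i) + \<zeta> 0)"
    unfolding z_def cart_kernel_def sum_coord[where h = "\<lambda>x. x"] by (simp add: cd_unit_def)
  have z: "z k = - \<psi> k" if "k \<noteq> 0" for k
  proof -
    have "(\<Sum>l = 1..?n. p l * coord e t l * cd_unit l k) = (if k \<in> {1..?n} then p k * coord e t k else 0)"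
      by (simp add: cd_unit_def if_distrib[of "(*) _"] cong: if_cong)
    then show ?thesis
      using that \<zeta> by (simp add: z_def cart_kernel_def \<psi>_def cd_params_def) (simp add: cd_unit_def)
  qed
  define \<rho> where "\<rho> = sqrt (\<Sum>l = 1..?n. (\<psi> l)\<^sup>2)"
  have \<rho>2: "\<rho>\<^sup>2 = (\<Sum>l = 1..?n. (\<psi> l)\<^sup>2)"
    by (simp add: \<rho>_def sum_nonneg)
  have "(\<Sum>l = 1..2 ^ r - 1. (z l)\<^sup>2) = (\<Sum>l = 1..2 ^ r - 1. (\<psi> l)\<^sup>2)"
    by (intro sum.cong) (auto simp: z)
  also have "\<dots> = \<rho>\<^sup>2"
    unfolding \<rho>2 using r by (intro sum.mono_neutral_right) (auto simp: \<psi>_def)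
  finally have "cd_exp r z b = exp (z 0) * (if b = 0 then cos \<rho> else if \<rho> = 0 then 0 else sin \<rho> / \<rho> * z b)"
    by (intro cd_exp_nth b) simp
  moreover have "(if b = 0 then cos \<rho> else if \<rho> = 0 then 0 else sin \<rho> / \<rho> * z b) = ?\<Psi> b \<psi>"
  proof (cases "b = 0")
    case True
    then show ?thesis
      unfolding \<rho>2[symmetric] by (simp add: cos_root_0_power2)
  next
    case False
    show ?thesis
    proof (cases "\<rho> = 0")
      case True
      then have "\<psi> b = 0" if "b \<le> ?n"
        using \<rho>2 that False by (auto simp: sum_nonneg_eq_0_iff)
      then show ?thesis using False True by auto
    next
      case \<rho>: False
      have "sin \<rho> / \<rho> = - 2 * cos_root 1 (\<rho>\<^sup>2)"
        using cos_root_1_power2[of \<rho>] \<rho> by (simp add: field_simps)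
      then show ?thesis
        unfolding \<rho>2[symmetric] using False \<rho> z[OF False] by (auto simp: \<psi>_def)
    qed
  qed
  ultimately have "cd_exp r z b = exp (z 0) * ?\<Psi> b \<psi>"
    by simp
  then show "cd_exp r (\<lambda>k. - cart_kernel e p t \<zeta> k) b = exp (- (p 0 * (\<Sum>i\<in>UNIV. t $ i) + \<zeta> 0)) *
      ?\<Psi> b (\<lambda>k. if k \<in> {1..?n} then p k * coord e t k + \<zeta> k else 0)"
    unfolding z_def[symmetric] z0[symmetric] \<psi>_def .
qed

text \<open>Spherical coordinates describe a unit vector: each step splits the last squared product
  by cos^2 + sin^2 = 1.\<close>

lemma sum_spherical_squares:
  "(\<Sum>k = 1..m. ((\<Prod>l = 2..k. sin (\<phi> l)) * cos (\<phi> (Suc k)))\<^sup>2) + (\<Prod>l = 2..Suc m. sin (\<phi> l))\<^sup>2 = (1 :: real)"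
proof (induction m)
  case (Suc m)
  have "(\<Prod>l = 2..Suc (Suc m). sin (\<phi> l)) = (\<Prod>l = 2..Suc m. sin (\<phi> l)) * sin (\<phi> (Suc (Suc m)))"
    by simp
  then have "((\<Prod>l = 2..Suc m. sin (\<phi> l)) * cos (\<phi> (Suc (Suc m))))\<^sup>2 + (\<Prod>l = 2..Suc (Suc m). sin (\<phi> l))\<^sup>2 =
      (\<Prod>l = 2..Suc m. sin (\<phi> l))\<^sup>2 * ((cos (\<phi> (Suc (Suc m))))\<^sup>2 + (sin (\<phi> (Suc (Suc m))))\<^sup>2)"
    by (simp only: power_mult_distrib distrib_left)
  with Suc show ?case
    by (simp del: prod.cl_ivl_Suc)
qed simp

text \<open>The imaginary part is \<psi>_1 times a unit vector up to sign, so \<rho> = \<psi>_1 may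
  be taken in \<open>cd_exp_nth\<close>, whatever its sign. It cancels the denominator of sin
  \<psi>_1 / \<psi>_1, and only sines and cosines of phases remain.\<close>

lemma phase_kernel_sph:
  assumes r: "CARD('n) < 2 ^ r" "2 \<le> r" and p: "p \<in> cd_params r CARD('n)"
  shows "phase_kernel r CARD('n) p (sph_kernel r e) (\<lambda>k. t_of_s e (axis (e k) 1)) (\<lambda>k t. tail_sum e t k)
    (\<lambda>k. if k = 1 then 1 else 0)
    (\<lambda>b \<psi>. if b = 0 then cos (\<psi> 1)
      else - 1 * sin (\<psi> 1) * ((\<Prod>l = 2..b. sin (\<psi> l)) * (if b < 2 ^ r - 1 then cos (\<psi> (Suc b)) else 1)))"
    (is "phase_kernel _ ?n _ _ ?d _ _ ?\<Psi>")
proof (rule phase_kernel.intro)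
  show "?n < 2 ^ r" by fact
  show "linear (\<lambda>t. tail_sum e t k)" for k by (rule linear_tail_sum)
  show "tail_sum e (?d l) k = (if k = l then 1 else 0)" if "k \<in> {1..?n}" "l \<in> {1..?n}" for k l
    unfolding tail_sum_t_of_s[OF that(1)] using that by (rule coord_axis)
  show "\<bar>tail_sum e t k\<bar> \<le> (\<Sum>i\<in>UNIV. \<bar>t $ i\<bar>)" for k t by (rule abs_tail_sum_le)
  show "(\<Sum>i\<in>UNIV. ?d k $ i) = (if k = 1 then 1 else 0)" if "k \<in> {1..?n}" for k
  proof -
    have "1 \<in> {1..?n}" using that by auto
    then show ?thesis
      unfolding tail_sum_1[symmetric] tail_sum_t_of_s[OF \<open>1 \<in> {1..?n}\<close>] using coord_axis[of 1 k] that by auto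
  qed
  show "tempered ?n (?\<Psi> b)" for b
    by (intro tempered_if tempered.intros tempered_prod finite_atLeastAtMost)
  fix \<zeta> t and b :: nat assume \<zeta>: "\<zeta> \<in> cd_params r ?n" and b: "b < 2 ^ r"
  define K :: nat where "K = 2 ^ r - 1"
  have K: "2 \<le> K"
  proof -
    have "(2::nat) ^ 2 \<le> 2 ^ r" using r(2) by (intro power_increasing) auto
    then show ?thesis by (simp add: K_def)
  qed
  have n_K: "?n \<le> K" using r(1) by (simp add: K_def)
  define \<psi> where "\<psi> = (\<lambda>k. if k \<in> {1..?n} then p k * tail_sum e t k + \<zeta> k else 0)"
  \<comment> \<open>The last coordinate b = K consists of sines only, hence the default 1 in place
    of a further cosine.\<close>
  define q where "q = (\<lambda>b. (\<Prod>l = 2..b. sin (\<psi> l)) * (if b < K then cos (\<psi> (Suc b)) else 1))"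
  define z where "z = (\<lambda>k. - sph_kernel r e p t \<zeta> k)"
  \<comment> \<open>Phases of index above n vanish because both \<open>p\<close> and \<zeta> lie in
    \<open>cd_params\<close>.\<close>
  have phase: "sph_phase e p t \<zeta> k = \<psi> k" if "k \<ge> 1" for k
    using that p \<zeta> by (simp add: sph_phase_def \<psi>_def cd_params_def)
  have M: "sph_M K (sph_phase e p t \<zeta>) k = (if k \<in> {1..K} then \<psi> 1 * q k else 0)" for k
  proof -
    have prod: "(\<Prod>l = 2..k. sin (sph_phase e p t \<zeta> l)) = (\<Prod>l = 2..k. sin (\<psi> l))" for k
      by (intro prod.cong) (auto simp: phase)
    have "(\<Sum>i = 1..K - 1. (\<Prod>l = 2..i. sin (\<psi> l)) * cos (\<psi> (i + 1)) * cd_unit i k) =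
        (if k \<in> {1..K - 1} then (\<Prod>l = 2..k. sin (\<psi> l)) * cos (\<psi> (k + 1)) else 0)"
      by (simp add: cd_unit_def if_distrib[of "(*) _"] cong: if_cong)
    then have "sph_M K (sph_phase e p t \<zeta>) k = \<psi> 1 *
        ((if k \<in> {1..K - 1} then (\<Prod>l = 2..k. sin (\<psi> l)) * cos (\<psi> (k + 1)) else 0) +
          (\<Prod>l = 2..K. sin (\<psi> l)) * cd_unit K k)"
      unfolding sph_M_def prod by (simp add: phase)
    then show ?thesis
      using K by (auto simp: q_def cd_unit_def)
  qed
  have z0: "z 0 = - (p 0 * (\<Sum>i\<in>UNIV. t $ i) + \<zeta> 0)"
    unfolding z_def sph_kernel_def K_def[symmetric] M tail_sum_1 by (simp add: cd_unit_def)
  have z: "z k = - (\<psi> 1 * q k)" if "k \<in> {1..K}" for k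
    using that unfolding z_def sph_kernel_def K_def[symmetric] M by (simp add: cd_unit_def)
  have q: "(\<Sum>k = 1..K. (q k)\<^sup>2) = 1"
  proof -
    obtain m where m: "K = Suc m" using K by (cases K) auto
    have "(\<Sum>k = 1..m. (q k)\<^sup>2) = (\<Sum>k = 1..m. ((\<Prod>l = 2..k. sin (\<psi> l)) * cos (\<psi> (Suc k)))\<^sup>2)"
      by (intro sum.cong) (auto simp: q_def m)
    moreover have "q (Suc m) = (\<Prod>l = 2..Suc m. sin (\<psi> l))"
      by (simp add: q_def m)
    ultimately show ?thesis
      using sum_spherical_squares[of \<psi> m] by (simp add: m del: prod.cl_ivl_Suc)
  qed
  have "(\<Sum>l = 1..K. (z l)\<^sup>2) = (\<Sum>l = 1..K. (\<psi> 1)\<^sup>2 * (q l)\<^sup>2)"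
    by (intro sum.cong refl) (simp add: z power_mult_distrib)
  then have "(\<psi> 1)\<^sup>2 = (\<Sum>l = 1..2 ^ r - 1. (z l)\<^sup>2)"
    unfolding K_def[symmetric] sum_distrib_left[symmetric] q by simp
  then have "cd_exp r z b = exp (z 0) *
      (if b = 0 then cos (\<psi> 1) else if \<psi> 1 = 0 then 0 else sin (\<psi> 1) / \<psi> 1 * z b)"
    by (rule cd_exp_nth[OF b])
  moreover have "b \<in> {1..K}" if "b \<noteq> 0"
    using that b lessThan_two_power[of r] by (auto simp: K_def)
  ultimately have "cd_exp r z b = exp (z 0) * (if b = 0 then cos (\<psi> 1) else - 1 * sin (\<psi> 1) * q b)"
    using z[of b] by (auto simp: K_def)
  then show "cd_exp r (\<lambda>k. - sph_kernel r e p t \<zeta> k) b = exp (- (p 0 * (\<Sum>i\<in>UNIV. t $ i) + \<zeta> 0)) *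
      ?\<Psi> b (\<lambda>k. if k \<in> {1..?n} then p k * tail_sum e t k + \<zeta> k else 0)"
    unfolding z_def[symmetric] z0[symmetric] q_def K_def \<psi>_def .
qed

end

text \<open>Growth exponents of a function are not unique, so \<open>a\<close> and \<open>b\<close>
  range over all choices satisfying the bounds. Convergence and existence of the \<zeta>-derivatives
  belong to the conclusion because the integral and \<open>deriv\<close> also have values where they
  are not meaningful.\<close>

theorem theorem21:
  fixes r n :: nat and e :: "nat \<Rightarrow> 'n::finite" and j :: "nat \<Rightarrow> nat"
    and f :: "real ^ 'n \<Rightarrow> cd" and p \<zeta> :: cd
  assumes "2 \<le> r" and "2 ^ (r - 1) \<le> n" and "n \<le> 2 ^ r - 1"
    and "CARD('n) = n" and "bij_betw e {1..n} UNIV"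
    and "is_original r f"
    and "p \<in> cd_params r n" and "\<zeta> \<in> cd_params r n"
  shows
    "(\<forall>a b :: (nat \<Rightarrow> nat) \<Rightarrow> real.
        (\<forall>m\<in>multi_below n j. s_pderiv_exists e m f \<and> exp_growth r (a m) (b m) (s_pderiv e m f)) \<and>
        is_original r (s_pderiv e j f) \<and>
        Max (a ` multi_below n j) < Min (b ` multi_below n j) \<and>
        Max (a ` multi_below n j) < cd_Re r p \<and> cd_Re r p < Min (b ` multi_below n j) \<longrightarrow>
        transform_converges r (sph_kernel r e) f p \<zeta> \<and>
        transform_converges r (sph_kernel r e) (s_pderiv e j f) p \<zeta> \<and>
        (\<forall>m\<in>multi_below n j. mixed_pderiv_exists cd_shift (cd_params r n) n m
          (transform r (sph_kernel r e) f p)) \<and>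
        transform r (sph_kernel r e) (s_pderiv e j f) p \<zeta> =
          (\<lambda>i. \<Sum>k = 0..j 1. real (j 1 choose k) * p 0 ^ (j 1 - k) *
            (pS_op p 1 ^^ k) (foldr (\<lambda>l. pS_op p l ^^ j l) [2..<Suc n]
              (transform r (sph_kernel r e) f p)) \<zeta> i))
     \<and>
     (\<forall>a b :: (nat \<Rightarrow> nat) \<Rightarrow> real.
        (\<forall>m\<in>multi_below n j. t_pderiv_exists e m f \<and> exp_growth r (a m) (b m) (t_pderiv e m f)) \<and>
        is_original r (t_pderiv e j f) \<and>
        Max (a ` multi_below n j) < Min (b ` multi_below n j) \<and>
        Max (a ` multi_below n j) < cd_Re r p \<and> cd_Re r p < Min (b ` multi_below n j) \<longrightarrow>
        transform_converges r (cart_kernel e) f p \<zeta> \<and>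
        transform_converges r (cart_kernel e) (t_pderiv e j f) p \<zeta> \<and>
        (\<forall>m\<in>multi_below n j. mixed_pderiv_exists cd_shift (cd_params r n) n m
          (transform r (cart_kernel e) f p)) \<and>
        transform r (cart_kernel e) (t_pderiv e j f) p \<zeta> =
          foldr (\<lambda>l. p0_pS_op p l ^^ j l) [1..<Suc n]
            (transform r (cart_kernel e) f p) \<zeta>)"
proof -
  have e: "bij_betw e {1..CARD('n)} UNIV" and p: "p \<in> cd_params r CARD('n)"
    and \<zeta>: "\<zeta> \<in> cd_params r CARD('n)" and n: "n = CARD('n)"
    using assms by simp_all
  have "(0::nat) < 2 ^ r" by simp
  then have less: "CARD('n) < 2 ^ r"
    using assms(3,4) by linarith
  have "(1::nat) \<le> 2 ^ (r - 1)" by simp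
  then have n1: "1 \<le> CARD('n)"
    using assms(2,4) by linarith
  note S = phase_kernel.transform_derivative_formula[OF phase_kernel_sph[OF e less assms(1) p] assms(6) _ _ _ \<zeta>,
      folded s_pderiv_eq[OF e]]
  note C = phase_kernel.transform_derivative_formula[OF phase_kernel_cart[OF e less] assms(6) _ _ _ \<zeta>,
      folded vec_shift_eq[OF e], folded t_pderiv_def t_pderiv_exists_def]
  have D_1: "D_op (\<lambda>_. 1) p = p0_pS_op p"
    by (simp add: D_op_def p0_pS_op_def fun_eq_iff)
  have D_sph: "foldr (\<lambda>k. D_op (\<lambda>k. if k = 1 then 1 else 0) p k ^^ j k) [1..<Suc CARD('n)] G =
      (p0_pS_op p 1 ^^ j 1) (foldr (\<lambda>l. pS_op p l ^^ j l) [2..<Suc CARD('n)] G)" for G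
  proof -
    \<comment> \<open>\<sigma>_1 = 1 leaves p_0 + p_1 S_1 in the outermost place, and \<sigma>_k = 0
      removes p_0 from the others; the binomial theorem then gives the stated sum.\<close>
    have "D_op (\<lambda>k. if k = 1 then 1 else 0) p 1 = p0_pS_op p 1"
      by (simp add: D_op_def p0_pS_op_def fun_eq_iff)
    moreover have "D_op (\<lambda>k. if k = 1 then 1 else 0) p k = pS_op p k" if "k \<noteq> 1" for k
      using that by (simp add: D_op_def fun_eq_iff)
    then have "foldr (\<lambda>k. D_op (\<lambda>k. if k = 1 then 1 else 0) p k ^^ j k) [2..<Suc CARD('n)] G =
        foldr (\<lambda>l. pS_op p l ^^ j l) [2..<Suc CARD('n)] G"
      by (intro foldr_cong) auto
    moreover have "[1..<Suc CARD('n)] = 1 # [2..<Suc CARD('n)]"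
      using n1 by (simp add: upt_conv_Cons numeral_2_eq_2 del: upt_Suc)
    ultimately show ?thesis
      by (simp del: upt_Suc)
  qed
  show ?thesis
    unfolding n cd_Re_eq
  proof (intro conjI[of "\<forall>a b. _ a b"] allI impI)
    fix a b :: "(nat \<Rightarrow> nat) \<Rightarrow> real"
    assume *: "(\<forall>m\<in>multi_below CARD('n) j.
        s_pderiv_exists e m f \<and> exp_growth r (a m) (b m) (s_pderiv e m f)) \<and>
      is_original r (s_pderiv e j f) \<and>
      Max (a ` multi_below CARD('n) j) < Min (b ` multi_below CARD('n) j) \<and>
      Max (a ` multi_below CARD('n) j) < p 0 \<and> p 0 < Min (b ` multi_below CARD('n) j)"
    then have "\<forall>m\<in>multi_below CARD('n) j.
        mixed_pderiv_exists (dir_shift (\<lambda>k. t_of_s e (axis (e k) 1))) UNIV CARD('n) m f \<and>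
        exp_growth r (a m) (b m) (s_pderiv e m f)"
      using s_pderiv_exists_imp[OF e] by blast
    note S = S[OF this]
    show "transform_converges r (sph_kernel r e) f p \<zeta> \<and>
        transform_converges r (sph_kernel r e) (s_pderiv e j f) p \<zeta> \<and>
        (\<forall>m\<in>multi_below CARD('n) j. mixed_pderiv_exists cd_shift (cd_params r CARD('n)) CARD('n) m
          (transform r (sph_kernel r e) f p)) \<and>
        transform r (sph_kernel r e) (s_pderiv e j f) p \<zeta> =
          (\<lambda>i. \<Sum>k = 0..j 1. real (j 1 choose k) * p 0 ^ (j 1 - k) *
            (pS_op p 1 ^^ k) (foldr (\<lambda>l. pS_op p l ^^ j l) [2..<Suc CARD('n)]
              (transform r (sph_kernel r e) f p)) \<zeta> i)"
      using S(2-5) * D_sph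
        phase_kernel.p0_pS_op_funpow_transform[OF phase_kernel_sph[OF e less assms(1) p] S(1) n1 \<zeta>]
      by (simp del: upt_Suc)
  next
    fix a b :: "(nat \<Rightarrow> nat) \<Rightarrow> real"
    assume *: "(\<forall>m\<in>multi_below CARD('n) j.
        t_pderiv_exists e m f \<and> exp_growth r (a m) (b m) (t_pderiv e m f)) \<and>
      is_original r (t_pderiv e j f) \<and>
      Max (a ` multi_below CARD('n) j) < Min (b ` multi_below CARD('n) j) \<and>
      Max (a ` multi_below CARD('n) j) < p 0 \<and> p 0 < Min (b ` multi_below CARD('n) j)"
    then have "\<forall>m\<in>multi_below CARD('n) j.
        t_pderiv_exists e m f \<and> exp_growth r (a m) (b m) (t_pderiv e m f)"
      by blast
    note C = C[OF this]
    show "transform_converges r (cart_kernel e) f p \<zeta> \<and>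
        transform_converges r (cart_kernel e) (t_pderiv e j f) p \<zeta> \<and>
        (\<forall>m\<in>multi_below CARD('n) j. mixed_pderiv_exists cd_shift (cd_params r CARD('n)) CARD('n) m
          (transform r (cart_kernel e) f p)) \<and>
        transform r (cart_kernel e) (t_pderiv e j f) p \<zeta> =
          foldr (\<lambda>l. p0_pS_op p l ^^ j l) [1..<Suc CARD('n)] (transform r (cart_kernel e) f p) \<zeta>"
      using C(2-5) * D_1 by (simp del: upt_Suc)
  qed
qed

end
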